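(* For every $n\ge1$, the four bistatistics $(\mathrm{exc},\mathrm{pcyc})$, $(\mathrm{exc},\mathrm{ear})$, $(\mathrm{des},\mathrm{des}_2)$ and $(\mathrm{exc},\mathrm{pex})$ are equidistributed over $\mathfrak S_n$; that is, the polynomial $\sum_{\sigma\in\mathfrak S_n}x^{s_1(\sigma)}y^{s_2(\sigma)}$ is the same for each of these four pairs $(s_1,s_2)$.
   Context: $\mathfrak S_n$ is the set of permutations of $[n]=\{1,\dots,n\}$. For $\sigma\in\mathfrak S_n$: - $\mathrm{exc}\,\sigma$ is the number of $i$ with $\sigma(i)>i$; $\mathrm{pex}\,\sigma$ is the number of $i$ with $\sigma(i)>i$ and $\sigma(j)\notin[i,\sigma(i)]$ for all $j<i$. - $\mathrm{pcyc}\,\sigma=\mathrm{cyc}\,\sigma-\mathrm{fix}\,\sigma$, where $\mathrm{cyc}\,\sigma$ is the number of cycles (fixed points included) and $\mathrm{fix}\,\sigma$ the number of fixed points. - An index $i$ is a record if $\sigma(j)<\sigma(i)$ for all $j<i$; an antirecord if $\sigma(j)>\sigma(i)$ for all $j>i$; an exclusive antirecord if it is an antirecord and not a record; a cycle peak if $\sigma^{-1}(i)<i>\sigma(i)$. $\mathrm{ear}\,\sigma$ is the number of $i$ that are both an exclusive antirecord and a cycle peak. - $\mathrm{des}\,\sigma$ is the number of descents, i.e. $i\in[1,n-1]$ with $\sigma(i)>\sigma(i+1)$; $\mathrm{des}_2\,\sigma$ is the number of descents $i$ with $\sigma(j)<\sigma(i)$ for all $j<i$. *)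

theory Defs
  imports "HOL-Combinatorics.Combinatorics" "HOL-Computational_Algebra.Polynomial"
begin

text \<open>
  The symmetric group on \<open>{1..n}\<close> is \<open>{\<sigma>. \<sigma> permutes {1..n}}\<close>; its elements are total
  functions on \<^typ>\<open>nat\<close> fixing every point outside \<open>{1..n}\<close>, so the statistics below take
  \<open>n\<close> as an explicit argument and only count and quantify over indices in \<open>{1..n}\<close>.
\<close>

definition exc :: "nat \<Rightarrow> (nat \<Rightarrow> nat) \<Rightarrow> nat" where
  "exc n \<sigma> = card {i \<in> {1..n}. \<sigma> i > i}"

definition pex :: "nat \<Rightarrow> (nat \<Rightarrow> nat) \<Rightarrow> nat" where
  "pex n \<sigma> = card {i \<in> {1..n}. \<sigma> i > i \<and> (\<forall>j \<in> {1..<i}. \<sigma> j \<notin> {i..\<sigma> i})}"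

definition cyc :: "nat \<Rightarrow> (nat \<Rightarrow> nat) \<Rightarrow> nat" where
  "cyc n \<sigma> = card ((\<lambda>i. Orbits.orbit \<sigma> i) ` {1..n})"

definition fixpts :: "nat \<Rightarrow> (nat \<Rightarrow> nat) \<Rightarrow> nat" where
  "fixpts n \<sigma> = card {i \<in> {1..n}. \<sigma> i = i}"

definition pcyc :: "nat \<Rightarrow> (nat \<Rightarrow> nat) \<Rightarrow> nat" where
  "pcyc n \<sigma> = cyc n \<sigma> - fixpts n \<sigma>"

text \<open>The subtraction on \<^typ>\<open>nat\<close> in the definition of \<^const>\<open>pcyc\<close> never truncates:\<close>

lemma fixpts_le_cyc: "fixpts n \<sigma> \<le> cyc n \<sigma>"
  unfolding fixpts_def cyc_def
proof (rule card_inj_on_le)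
  show "inj_on (\<lambda>i. Orbits.orbit \<sigma> i) {i \<in> {1..n}. \<sigma> i = i}"
    by (rule inj_onI) (metis (mono_tags, lifting) mem_Collect_eq orbit_eq_singleton_iff singleton_inject)
qed auto

definition is_record :: "nat \<Rightarrow> (nat \<Rightarrow> nat) \<Rightarrow> nat \<Rightarrow> bool" where
  "is_record n \<sigma> i \<longleftrightarrow> i \<in> {1..n} \<and> (\<forall>j \<in> {1..<i}. \<sigma> j < \<sigma> i)"

definition is_antirecord :: "nat \<Rightarrow> (nat \<Rightarrow> nat) \<Rightarrow> nat \<Rightarrow> bool" where
  "is_antirecord n \<sigma> i \<longleftrightarrow> i \<in> {1..n} \<and> (\<forall>j \<in> {i<..n}. \<sigma> j > \<sigma> i)"

definition is_exclusive_antirecord :: "nat \<Rightarrow> (nat \<Rightarrow> nat) \<Rightarrow> nat \<Rightarrow> bool" where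
  "is_exclusive_antirecord n \<sigma> i \<longleftrightarrow> is_antirecord n \<sigma> i \<and> \<not> is_record n \<sigma> i"

definition is_cycle_peak :: "nat \<Rightarrow> (nat \<Rightarrow> nat) \<Rightarrow> nat \<Rightarrow> bool" where
  "is_cycle_peak n \<sigma> i \<longleftrightarrow> i \<in> {1..n} \<and> inv \<sigma> i < i \<and> i > \<sigma> i"

definition ear :: "nat \<Rightarrow> (nat \<Rightarrow> nat) \<Rightarrow> nat" where
  "ear n \<sigma> = card {i \<in> {1..n}. is_exclusive_antirecord n \<sigma> i \<and> is_cycle_peak n \<sigma> i}"

definition is_descent :: "nat \<Rightarrow> (nat \<Rightarrow> nat) \<Rightarrow> nat \<Rightarrow> bool" where
  "is_descent n \<sigma> i \<longleftrightarrow> i \<in> {1..<n} \<and> \<sigma> i > \<sigma> (i + 1)"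

definition des :: "nat \<Rightarrow> (nat \<Rightarrow> nat) \<Rightarrow> nat" where
  "des n \<sigma> = card {i \<in> {1..<n}. is_descent n \<sigma> i}"

definition des2 :: "nat \<Rightarrow> (nat \<Rightarrow> nat) \<Rightarrow> nat" where
  "des2 n \<sigma> = card {i \<in> {1..<n}. is_descent n \<sigma> i \<and> (\<forall>j \<in> {1..<i}. \<sigma> j < \<sigma> i)}"

text \<open>
  The generating polynomial lies in \<open>\<int>[x, y]\<close>, represented as \<open>\<int>[y][x]\<close>:
  \<open>x = [:0, 1:]\<close> is the outer variable and \<open>y = [:[:0, 1:]:]\<close> the inner one.
\<close>

definition bistat_poly ::
    "nat \<Rightarrow> ((nat \<Rightarrow> nat) \<Rightarrow> nat) \<Rightarrow> ((nat \<Rightarrow> nat) \<Rightarrow> nat) \<Rightarrow> int poly poly" where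
  "bistat_poly n s1 s2 =
     (\<Sum>\<sigma> | \<sigma> permutes {1..n}. [:0, 1:] ^ s1 \<sigma> * [:[:0, 1:]:] ^ s2 \<sigma>)"

end

theory Submission
  imports Defs "HOL-Computational_Algebra.Formal_Power_Series"
begin

text \<open>
  Build the graph of a permutation by inserting \<open>1, 2, \<dots>, n\<close> one at a time. After \<open>n\<close> steps one sees
  a partial injection of \<open>[n]\<close> with \<open>h\<close> points lacking an image and \<open>h\<close> lacking a preimage.
  The new point is isolated, is fixed, receives one of the \<open>h\<close> sources (creating an excedance), is
  sent to one of the \<open>h\<close> targets, or does both; the last case happens exactly at cycle peaks. Each of
  \<open>pcyc\<close>, \<open>ear\<close> and (after the reversal of the inverse) \<open>pex\<close> counts the cycle peaks at which the pair
  (source, target) belongs to a distinguished set of \<open>h\<close> out of the \<open>h\<^sup>2\<close> pairs. Hence all three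
  weighted sums \<open>W(n, h)\<close> satisfy
  \<open>W(n+1, h) = W(n, h-1) + (1 + h(1+x)) W(n, h) + x (h+1) (h+y) W(n, h+1)\<close>.

  For descents, cutting a word at its maximum shows that the exponential generating functions
  \<open>P\<close> of \<open>(des, des2)\<close> and \<open>T = P|\<^bsub>y=1\<^esub> - 1\<close> satisfy \<open>P' = P (1 + x y T)\<close> and
  \<open>T' = (1 + T) (1 + x T)\<close>, so that the coefficients of \<open>P T\<^sup>h / h!\<close> obey the same recurrence.
\<close>

section \<open>Partial injections and cycle peaks\<close>

definition partial_inj :: "nat \<Rightarrow> (nat \<times> nat) set set" where
  "partial_inj n = {R. R \<subseteq> {1..n} \<times> {1..n} \<and> single_valued R \<and> single_valued (R\<inverse>)}"

definition restr :: "nat \<Rightarrow> (nat \<times> nat) set \<Rightarrow> (nat \<times> nat) set" where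
  "restr n R = R \<inter> {1..n} \<times> {1..n}"

definition src :: "nat \<Rightarrow> (nat \<times> nat) set \<Rightarrow> nat set" where
  "src n R = {1..n} - Domain R"

definition tgt :: "nat \<Rightarrow> (nat \<times> nat) set \<Rightarrow> nat set" where
  "tgt n R = {1..n} - Range R"

text \<open>An element is the set of pairs that the point \<open>Suc n\<close> brings in. The fixed
  point is listed apart because \<open>src n R\<close> and \<open>tgt n R\<close> contain only
  points up to \<open>n\<close>.\<close>

definition exts :: "nat \<Rightarrow> (nat \<times> nat) set \<Rightarrow> (nat \<times> nat) set set" where
  "exts n R = insert {} (insert {(Suc n, Suc n)}
     ((\<lambda>i. {(i, Suc n)}) ` src n R \<union> (\<lambda>v. {(Suc n, v)}) ` tgt n R \<union>
      (\<lambda>(i, v). {(i, Suc n), (Suc n, v)}) ` (src n R \<times> tgt n R)))"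

lemma finite_partial_inj: "finite (partial_inj n)"
  by (rule finite_subset[of _ "Pow ({1..n} \<times> {1..n})"]) (auto simp: partial_inj_def)

lemma partial_inj_finite: "R \<in> partial_inj n \<Longrightarrow> finite R"
  unfolding partial_inj_def by (auto intro: finite_subset)

lemma finite_src [simp]: "finite (src n R)" and finite_tgt [simp]: "finite (tgt n R)"
  by (auto simp: src_def tgt_def)

lemma card_src:
  assumes "R \<in> partial_inj n" shows "card (src n R) = n - card R"
proof -
  have "inj_on fst R"
    using assms by (auto simp: partial_inj_def single_valued_def inj_on_def)
  moreover have "fst ` R = Domain R" by (simp add: Domain_fst)
  ultimately have "card (Domain R) = card R" by (metis card_image)
  moreover have "Domain R \<subseteq> {1..n}" using assms by (auto simp: partial_inj_def)
  ultimately show ?thesis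
    by (simp add: src_def card_Diff_subset finite_subset)
qed

lemma card_tgt:
  assumes "R \<in> partial_inj n" shows "card (tgt n R) = n - card R"
proof -
  have "inj_on snd R"
    using assms by (auto simp: partial_inj_def single_valued_def inj_on_def)
  moreover have "snd ` R = Range R" by (simp add: Range_snd)
  ultimately have "card (Range R) = card R" by (metis card_image)
  moreover have "Range R \<subseteq> {1..n}" using assms by (auto simp: partial_inj_def)
  ultimately show ?thesis
    by (simp add: tgt_def card_Diff_subset finite_subset)
qed

lemma card_partial_inj_le:
  assumes "R \<in> partial_inj n" shows "card R \<le> n"
proof -
  have "inj_on fst R" "fst ` R \<subseteq> {1..n}"
    using assms by (auto simp: partial_inj_def single_valued_def inj_on_def)
  then show ?thesis by (metis card_inj_on_le card_atLeastAtMost diff_Suc_1 finite_atLeastAtMost)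
qed

lemma exts_cases:
  assumes "X \<in> exts n R"
  obtains "X = {}" | "X = {(Suc n, Suc n)}" | i where "i \<in> src n R" "X = {(i, Suc n)}"
  | v where "v \<in> tgt n R" "X = {(Suc n, v)}"
  | i v where "i \<in> src n R" "v \<in> tgt n R" "X = {(i, Suc n), (Suc n, v)}"
  using assms unfolding exts_def by auto

lemma partial_injI:
  assumes "\<And>a b. (a, b) \<in> R \<Longrightarrow> a \<in> {1..n} \<and> b \<in> {1..n}"
    and "\<And>a b c. (a, b) \<in> R \<Longrightarrow> (a, c) \<in> R \<Longrightarrow> b = c"
    and "\<And>a b c. (a, c) \<in> R \<Longrightarrow> (b, c) \<in> R \<Longrightarrow> a = b"
  shows "R \<in> partial_inj n"
  using assms unfolding partial_inj_def single_valued_def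
  by (intro CollectI conjI subsetI allI impI) auto

lemma partial_injD:
  assumes "R \<in> partial_inj n"
  shows "(a, b) \<in> R \<Longrightarrow> a \<in> {1..n}" "(a, b) \<in> R \<Longrightarrow> b \<in> {1..n}"
    and "(a, b) \<in> R \<Longrightarrow> (a, c) \<in> R \<Longrightarrow> b = c"
    and "(a, c) \<in> R \<Longrightarrow> (b, c) \<in> R \<Longrightarrow> a = b"
  using assms unfolding partial_inj_def single_valued_def by blast+

lemma src_iff: "i \<in> src n R \<longleftrightarrow> 1 \<le> i \<and> i \<le> n \<and> (\<forall>v. (i, v) \<notin> R)"
  and tgt_iff: "v \<in> tgt n R \<longleftrightarrow> 1 \<le> v \<and> v \<le> n \<and> (\<forall>i. (i, v) \<notin> R)"
  by (auto simp: src_def tgt_def)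

lemma exts_in_partial_inj:
  assumes R: "R \<in> partial_inj n" and X: "X \<in> exts n R"
  shows "R \<union> X \<in> partial_inj (Suc n)"
proof -
  have out: "(a, Suc n) \<notin> R" "(Suc n, a) \<notin> R" for a
    using partial_injD[OF R] by fastforce+
  have sub: "1 \<le> a \<and> a \<le> Suc n \<and> 1 \<le> b \<and> b \<le> Suc n" if "(a, b) \<in> R" for a b
    using partial_injD(1,2)[OF R that] by simp
  show ?thesis
    using X
  proof (cases rule: exts_cases)
    case 1
    then show ?thesis
      using sub partial_injD(3,4)[OF R] by (intro partial_injI) auto
  next
    case 2
    then show ?thesis
      using out sub partial_injD(3,4)[OF R] by (intro partial_injI) auto
  next
    case (3 i)
    then show ?thesis
      using out sub partial_injD(3,4)[OF R] by (intro partial_injI) (auto simp: src_iff)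
  next
    case (4 v)
    then show ?thesis
      using out sub partial_injD(3,4)[OF R] by (intro partial_injI) (auto simp: tgt_iff)
  next
    case (5 i v)
    then show ?thesis
      using out sub partial_injD(3,4)[OF R]
      by (intro partial_injI) (auto simp: src_iff tgt_iff)
  qed
qed

lemma restr_exts:
  assumes R: "R \<in> partial_inj n" and X: "X \<in> exts n R"
  shows "restr n (R \<union> X) = R" and "X - R = X"
proof -
  have sub: "R \<subseteq> {1..n} \<times> {1..n}" using R by (auto simp: partial_inj_def)
  have X': "X \<inter> {1..n} \<times> {1..n} = {}"
    using X by (cases rule: exts_cases) auto
  show "restr n (R \<union> X) = R" using sub X' by (auto simp: restr_def)
  show "X - R = X" using sub X' by blast
qed

lemma restr_in_partial_inj: "R \<in> partial_inj (Suc n) \<Longrightarrow> restr n R \<in> partial_inj n"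
  unfolding partial_inj_def restr_def single_valued_def by blast

text \<open>The removed pairs are those touching \<open>Suc n\<close>. Single-valuedness in both
  directions leaves at most one pair into it and at most one out of it, and the case split asks
  which of these exist.\<close>

lemma diff_restr_in_exts:
  assumes R: "R \<in> partial_inj (Suc n)"
  shows "R - restr n R \<in> exts n (restr n R)"
proof -
  let ?N = "Suc n" and ?Q = "restr n R" and ?X = "R - restr n R"
  have sub: "\<And>a b. (a, b) \<in> R \<Longrightarrow> a \<in> {1..?N} \<and> b \<in> {1..?N}"
    and sv: "\<And>a b c. (a, b) \<in> R \<Longrightarrow> (a, c) \<in> R \<Longrightarrow> b = c"
    and inj: "\<And>a b c. (a, c) \<in> R \<Longrightarrow> (b, c) \<in> R \<Longrightarrow> a = b"
    using R unfolding partial_inj_def single_valued_def by blast+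
  have X: "(a, b) \<in> ?X \<longleftrightarrow> (a, b) \<in> R \<and> (a = ?N \<or> b = ?N)" for a b
    using sub[of a b] by (auto simp: restr_def)
  have X_eq: "?X = A" if "\<And>a b. (a, b) \<in> R \<and> (a = ?N \<or> b = ?N) \<longleftrightarrow> (a, b) \<in> A" for A
    using X that by (intro set_eqI) (metis surj_pair)
  have srcI: "i \<in> src n ?Q" if "(i, ?N) \<in> R" "i \<noteq> ?N" for i
  proof -
    have "(i, v) \<notin> ?Q" for v
      using sv[OF that(1), of v] by (auto simp: restr_def)
    then show ?thesis using sub[OF that(1)] that(2) by (auto simp: src_iff)
  qed
  have tgtI: "v \<in> tgt n ?Q" if "(?N, v) \<in> R" "v \<noteq> ?N" for v
  proof -
    have "(i, v) \<notin> ?Q" for i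
      using inj[OF that(1), of i] by (auto simp: restr_def)
    then show ?thesis using sub[OF that(1)] that(2) by (auto simp: tgt_iff)
  qed
  show ?thesis
  proof (cases "\<exists>i. (i, ?N) \<in> R")
    case True
    then obtain i where i: "(i, ?N) \<in> R" by blast
    show ?thesis
    proof (cases "\<exists>v. (?N, v) \<in> R")
      case True
      then obtain v where v: "(?N, v) \<in> R" by blast
      have "?X = {(i, ?N), (?N, v)}"
        by (rule X_eq) (use i v sv inj in blast)
      \<comment> \<open>If \<open>Suc n\<close> is its own preimage, it is also its own image, so
        the two pairs coincide and give the fixed-point extension; otherwise both ends are old
        points.\<close>
      moreover have "i = ?N \<longleftrightarrow> v = ?N" using i v sv inj by blast
      ultimately show ?thesis
        using srcI[OF i] tgtI[OF v] unfolding exts_def by (cases "i = ?N") auto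
    next
      case False
      have "?X = {(i, ?N)}"
        by (rule X_eq) (use i False inj in blast)
      moreover have "i \<noteq> ?N" using False i by blast
      ultimately show ?thesis using srcI[OF i] unfolding exts_def by simp
    qed
  next
    case no: False
    show ?thesis
    proof (cases "\<exists>v. (?N, v) \<in> R")
      case True
      then obtain v where v: "(?N, v) \<in> R" by blast
      have "?X = {(?N, v)}"
        by (rule X_eq) (use v no sv in blast)
      moreover have "v \<noteq> ?N" using no v by blast
      ultimately show ?thesis using tgtI[OF v] unfolding exts_def by simp
    next
      case False
      have "?X = {}"
        by (rule X_eq) (use False no in blast)
      then show ?thesis unfolding exts_def by simp
    qed
  qed
qed

text \<open>Deleting the point \<open>Suc n\<close> undoes an extension, so every partial injection
  on \<open>Suc n\<close> points arises from exactly one pair \<open>(R, X)\<close>.\<close>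

lemma sum_partial_inj_Suc:
  "(\<Sum>R\<in>partial_inj (Suc n). F R) = (\<Sum>R\<in>partial_inj n. \<Sum>X\<in>exts n R. F (R \<union> X))"
proof -
  have "(\<Sum>R\<in>partial_inj n. \<Sum>X\<in>exts n R. F (R \<union> X)) =
      (\<Sum>(R, X)\<in>(SIGMA R:partial_inj n. exts n R). F (R \<union> X))"
    by (rule sum.Sigma) (auto simp: finite_partial_inj exts_def)
  also have "\<dots> = (\<Sum>R\<in>partial_inj (Suc n). F R)"
  proof (rule sum.reindex_bij_witness[where i = "\<lambda>R. (restr n R, R - restr n R)"
        and j = "\<lambda>(R, X). R \<union> X"])
    fix p assume "p \<in> (SIGMA R:partial_inj n. exts n R)"
    then obtain R X where p: "p = (R, X)" "R \<in> partial_inj n" "X \<in> exts n R" by blast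
    then show "(restr n (case p of (R, X) \<Rightarrow> R \<union> X),
        (case p of (R, X) \<Rightarrow> R \<union> X) - restr n (case p of (R, X) \<Rightarrow> R \<union> X)) = p"
      and "(case p of (R, X) \<Rightarrow> R \<union> X) \<in> partial_inj (Suc n)"
      and "F (case p of (R, X) \<Rightarrow> R \<union> X) = (case p of (R, X) \<Rightarrow> F (R \<union> X))"
      using restr_exts[OF p(2,3)] exts_in_partial_inj[OF p(2,3)] by (simp_all add: Un_Diff)
  next
    fix R assume "R \<in> partial_inj (Suc n)"
    then show "(restr n R, R - restr n R) \<in> (SIGMA R:partial_inj n. exts n R)"
      by (simp add: restr_in_partial_inj diff_restr_in_exts)
    show "(case (restr n R, R - restr n R) of (R, X) \<Rightarrow> R \<union> X) = R"
      by (auto simp: restr_def)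
  qed
  finally show ?thesis by simp
qed

text \<open>The five kinds of extension are mutually exclusive, and within each kind the parameters
  can be read off the set because old points differ from \<open>Suc n\<close>.\<close>

lemma sum_exts:
  fixes F :: "(nat \<times> nat) set \<Rightarrow> 'a :: comm_monoid_add"
  shows "(\<Sum>X\<in>exts n R. F X) = F {} + F {(Suc n, Suc n)} + (\<Sum>i\<in>src n R. F {(i, Suc n)})
    + (\<Sum>v\<in>tgt n R. F {(Suc n, v)})
    + (\<Sum>(i, v)\<in>src n R \<times> tgt n R. F {(i, Suc n), (Suc n, v)})"
proof -
  let ?N = "Suc n" and ?a = "\<lambda>i. {(i, Suc n)}" and ?b = "\<lambda>v. {(Suc n, v)}"
    and ?c = "\<lambda>(i, v). {(i, Suc n), (Suc n, v)}"
  have ne: "i \<noteq> ?N" if "i \<in> src n R \<or> i \<in> tgt n R" for i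
    using that by (auto simp: src_def tgt_def)
  define A B C where "A = ?a ` src n R" and "B = ?b ` tgt n R"
    and "C = ?c ` (src n R \<times> tgt n R)"
  have fin: "finite A" "finite B" "finite C" by (auto simp: A_def B_def C_def)
  have inj: "inj_on ?a (src n R)" "inj_on ?b (tgt n R)" "inj_on ?c (src n R \<times> tgt n R)"
    using ne by (auto simp: inj_on_def doubleton_eq_iff)
  have d: "{} \<notin> A" "{} \<notin> B" "{} \<notin> C" "{(?N, ?N)} \<notin> A" "{(?N, ?N)} \<notin> B" "{(?N, ?N)} \<notin> C"
    "A \<inter> B = {}" "A \<inter> C = {}" "B \<inter> C = {}"
    using ne unfolding A_def B_def C_def by (auto dest!: equalityD2)
  have "sum F (exts n R) = sum F (insert {} (insert {(?N, ?N)} (A \<union> B \<union> C)))"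
    by (simp add: exts_def A_def B_def C_def)
  also have "\<dots> = F {} + (F {(?N, ?N)} + (sum F A + sum F B + sum F C))"
    using d fin by (simp add: sum.union_disjoint Int_Un_distrib2)
  also have "sum F A = (\<Sum>i\<in>src n R. F {(i, Suc n)})"
    unfolding A_def sum.reindex[OF inj(1)] by (simp add: o_def)
  also have "sum F B = (\<Sum>v\<in>tgt n R. F {(Suc n, v)})"
    unfolding B_def sum.reindex[OF inj(2)] by (simp add: o_def)
  also have "sum F C = (\<Sum>(i, v)\<in>src n R \<times> tgt n R. F {(i, Suc n), (Suc n, v)})"
    unfolding C_def sum.reindex[OF inj(3)] by (simp add: o_def case_prod_unfold)
  finally show ?thesis by (simp add: add.assoc)
qed

section \<open>Weights of partial injections and their recurrence\<close>

definition excs :: "(nat \<times> nat) set \<Rightarrow> (nat \<times> nat) set" where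
  "excs R = {(i, j) \<in> R. i < j}"

text \<open>The bounds on \<open>i\<close> and \<open>v\<close> say that \<open>k\<close> is a cycle
  peak. Whether it counts is decided by the state just before \<open>k\<close> was inserted, hence
  the index \<open>k - 1\<close>; this makes the count additive along the insertion process.\<close>

definition closers :: "(nat \<Rightarrow> (nat \<times> nat) set \<Rightarrow> (nat \<times> nat) set) \<Rightarrow> (nat \<times> nat) set \<Rightarrow> nat set" where
  "closers S R = {k. \<exists>i v. (i, k) \<in> R \<and> (k, v) \<in> R \<and> i < k \<and> v < k \<and> (i, v) \<in> S (k - 1) (restr (k - 1) R)}"

text \<open>Old points are judged by restrictions below themselves, which do not see
  \<open>Suc n\<close>; the only new candidate is \<open>Suc n\<close>.\<close>

lemma closers_Suc:
  assumes R: "R \<in> partial_inj (Suc n)"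
  shows "closers S R = closers S (restr n R) \<union>
    {k. k = Suc n \<and> (\<exists>i v. (i, k) \<in> R \<and> (k, v) \<in> R \<and> i < k \<and> v < k \<and> (i, v) \<in> S n (restr n R))}"
    (is "?L = ?M \<union> ?K")
proof -
  have sub: "\<And>a b. (a, b) \<in> R \<Longrightarrow> a \<in> {1..Suc n} \<and> b \<in> {1..Suc n}"
    using R unfolding partial_inj_def by blast
  have rr: "restr (k - 1) (restr n R) = restr (k - 1) R" if "k \<le> n" for k
    using that by (auto simp: restr_def)
  have "k \<in> ?L \<longleftrightarrow> k \<in> ?M \<union> ?K" for k
  proof (cases "k \<le> n")
    case True
    have "(i, k) \<in> R \<and> (k, v) \<in> R \<and> i < k \<and> v < k \<longleftrightarrow>
      (i, k) \<in> restr n R \<and> (k, v) \<in> restr n R \<and> i < k \<and> v < k" for i v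
      using sub[of i k] sub[of k v] True by (auto simp: restr_def)
    then have "k \<in> ?L \<longleftrightarrow> k \<in> ?M"
      unfolding closers_def mem_Collect_eq rr[OF True] by metis
    then show ?thesis using True by simp
  next
    case False
    then have M: "k \<notin> ?M" by (auto simp: closers_def restr_def)
    show ?thesis
    proof (cases "k = Suc n")
      case True
      then have "k \<in> ?L \<longleftrightarrow> k \<in> ?K" by (simp add: closers_def)
      with M show ?thesis by blast
    next
      case ne: False
      have "k \<notin> ?L"
      proof
        assume "k \<in> ?L"
        then obtain i where "(i, k) \<in> R" by (auto simp: closers_def)
        with sub[of i k] False ne show False by simp
      qed
      with M ne show ?thesis by simp
    qed
  qed
  then show ?thesis by blast
qed

definition weight :: "'a :: comm_ring_1 \<Rightarrow> 'a \<Rightarrow> (nat \<Rightarrow> (nat \<times> nat) set \<Rightarrow> (nat \<times> nat) set) \<Rightarrow>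
    (nat \<times> nat) set \<Rightarrow> 'a" where
  "weight x y S R = x ^ card (excs R) * y ^ card (closers S R)"

text \<open>Here \<open>n - card R\<close> is the number \<open>h\<close> of sources, which is also
  the number of targets. Fixing the number of distinguished pairs is enough for the recurrence, so
  quite different statistics can share it.\<close>

definition closing_rule :: "(nat \<Rightarrow> (nat \<times> nat) set \<Rightarrow> (nat \<times> nat) set) \<Rightarrow> bool" where
  "closing_rule S \<longleftrightarrow> (\<forall>n. \<forall>R\<in>partial_inj n.
     S n R \<subseteq> src n R \<times> tgt n R \<and> card (S n R) = n - card R)"

lemma closers_exts:
  assumes R: "R \<in> partial_inj n" and X: "X \<in> exts n R" and sub: "S n R \<subseteq> src n R \<times> tgt n R"
  shows "card (closers S (R \<union> X)) = card (closers S R) +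
    (if \<exists>(i, v)\<in>S n R. X = {(i, Suc n), (Suc n, v)} then 1 else 0)"
proof -
  let ?K = "{k. k = Suc n \<and> (\<exists>i v. (i, k) \<in> R \<union> X \<and> (k, v) \<in> R \<union> X \<and> i < k \<and> v < k \<and> (i, v) \<in> S n R)}"
  have out: "(a, Suc n) \<notin> R" "(Suc n, a) \<notin> R" for a
    using partial_injD[OF R] by fastforce+
  have "closers S (R \<union> X) = closers S R \<union> ?K"
    using closers_Suc[OF exts_in_partial_inj[OF R X], of S] unfolding restr_exts(1)[OF R X] .
  moreover have "?K = (if \<exists>(i, v)\<in>S n R. X = {(i, Suc n), (Suc n, v)} then {Suc n} else {})"
    (is "_ = (if ?c then _ else _)")
  proof (cases ?c)
    case True
    then obtain i v where iv: "(i, v) \<in> S n R" and X_eq: "X = {(i, Suc n), (Suc n, v)}" by blast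
    then have "i < Suc n" "v < Suc n" using sub by (auto simp: src_iff tgt_iff)
    then have "?K = {Suc n}" using iv X_eq by auto
    with True show ?thesis by simp
  next
    case False
    have "X = {(i, Suc n), (Suc n, v)}"
      if "(i, Suc n) \<in> X" "(Suc n, v) \<in> X" "i < Suc n" "v < Suc n" for i v
      using X by (cases rule: exts_cases) (use that in auto)
    then have "?K = {}" using False out by blast
    with False show ?thesis by simp
  qed
  moreover have "Suc n \<notin> closers S R" using out by (auto simp: closers_def)
  moreover have "finite (closers S R)"
    by (rule finite_subset[of _ "fst ` R"])
      (auto simp: closers_def image_iff Bex_def partial_inj_finite[OF R])
  ultimately show ?thesis by simp
qed

lemma weight_exts:
  assumes R: "R \<in> partial_inj n" and X: "X \<in> exts n R" and sub: "S n R \<subseteq> src n R \<times> tgt n R"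
  shows "weight x y S (R \<union> X) = weight x y S R * x ^ card (excs X) *
    (if \<exists>(i, v)\<in>S n R. X = {(i, Suc n), (Suc n, v)} then y else 1)"
    and "card (R \<union> X) = card R + card X"
proof -
  have fin: "finite R" "finite X"
    using partial_inj_finite[OF R] X by (auto elim: exts_cases)
  have dj: "R \<inter> X = {}" using restr_exts(2)[OF R X] by blast
  then show "card (R \<union> X) = card R + card X" using fin by (simp add: card_Un_disjoint)
  have "excs (R \<union> X) = excs R \<union> excs X" "excs R \<inter> excs X = {}"
    "finite (excs R)" "finite (excs X)"
    using dj fin by (auto simp: excs_def intro: finite_subset)
  then have "card (excs (R \<union> X)) = card (excs R) + card (excs X)"
    by (simp add: card_Un_disjoint)
  then show "weight x y S (R \<union> X) = weight x y S R * x ^ card (excs X) *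
      (if \<exists>(i, v)\<in>S n R. X = {(i, Suc n), (Suc n, v)} then y else 1)"
    by (simp add: weight_def closers_exts[where S = S, OF R X sub] power_add mult_ac)
qed

text \<open>The three terms collect the extensions by how the number \<open>h\<close> of sources
  changes: isolated point (up by one), fixed point or one link (unchanged), two links (down by one).
  The function \<open>g\<close> records the new number; its truncated argument at
  \<open>h = 0\<close> is multiplied by zero.\<close>

lemma sum_weight_Suc:
  fixes x y :: "'a :: comm_ring_1"
  assumes S: "closing_rule S"
  shows "(\<Sum>R\<in>partial_inj (Suc n). weight x y S R * g (Suc n - card R)) =
    (\<Sum>R\<in>partial_inj n. weight x y S R *
      (g (Suc (n - card R)) + (1 + of_nat (n - card R) * (1 + x)) * g (n - card R) +
       x * of_nat (n - card R) * (of_nat (n - card R) - 1 + y) * g (n - card R - 1)))"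
  unfolding sum_partial_inj_Suc
proof (rule sum.cong[OF refl])
  fix R assume R: "R \<in> partial_inj n"
  define h where "h = n - card R"
  let ?N = "Suc n" and ?w = "weight x y S R"
  have sub: "S n R \<subseteq> src n R \<times> tgt n R" and card_S: "card (S n R) = h"
    using S R by (auto simp: closing_rule_def h_def)
  have card_h: "card (src n R) = h" "card (tgt n R) = h"
    using card_src[OF R] card_tgt[OF R] by (auto simp: h_def)
  have le: "card R \<le> n" by (rule card_partial_inj_le[OF R])
  have lt: "i < ?N" if "i \<in> src n R \<or> i \<in> tgt n R" for i using that by (auto simp: src_iff tgt_iff)
  define F where "F X = weight x y S (R \<union> X) * g (?N - card (R \<union> X))" for X
  define e where "e X = (if \<exists>(i, v)\<in>S n R. X = {(i, ?N), (?N, v)} then y else 1)" for X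
  have F: "F X = ?w * x ^ card (excs X) * e X * g (?N - (card R + card X))" if "X \<in> exts n R" for X
    unfolding F_def e_def weight_exts(1)[where S = S and x = x and y = y, OF R that sub]
      weight_exts(2)[where S = S, OF R that sub] by (rule refl)
  \<comment> \<open>The bound \<open>le\<close> ensures that an isolated point really raises the
    natural-number difference by one.\<close>
  have F0: "F {} = ?w * g (Suc h)"
    by (subst F) (use le in \<open>auto simp: exts_def e_def excs_def h_def Suc_diff_le\<close>)
  have F1: "F {(?N, ?N)} = ?w * g h"
  proof -
    have "excs {(?N, ?N)} = {}" by (auto simp: excs_def)
    moreover have "e {(?N, ?N)} = 1" using lt sub by (auto simp: e_def)
    ultimately show ?thesis by (subst F) (auto simp: exts_def h_def)
  qed
  have F2: "F {(i, ?N)} = ?w * x * g h" if "i \<in> src n R" for i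
  proof -
    have "excs {(i, ?N)} = {(i, ?N)}" using lt that by (auto simp: excs_def)
    moreover have "e {(i, ?N)} = 1" using lt sub that by (auto simp: e_def)
    ultimately show ?thesis using that by (subst F) (auto simp: exts_def h_def)
  qed
  have F3: "F {(?N, v)} = ?w * g h" if "v \<in> tgt n R" for v
  proof -
    have "excs {(?N, v)} = {}" using lt[of v] that by (auto simp: excs_def)
    moreover have "e {(?N, v)} = 1" using lt sub that by (auto simp: e_def)
    ultimately show ?thesis using that by (subst F) (auto simp: exts_def h_def)
  qed
  have F4: "F {(i, ?N), (?N, v)} = ?w * x * g (h - 1) * (if (i, v) \<in> S n R then y else 1)"
    if "(i, v) \<in> src n R \<times> tgt n R" for i v
  proof -
    have iv: "i < ?N" "v < ?N" using lt that by auto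
    then have "excs {(i, ?N), (?N, v)} = {(i, ?N)}" by (auto simp: excs_def)
    moreover have "e {(i, ?N), (?N, v)} = (if (i, v) \<in> S n R then y else 1)"
      using iv by (auto simp: e_def doubleton_eq_iff)
    moreover have "card {(i, ?N), (?N, v)} = 2" using iv by auto
    ultimately show ?thesis using that by (subst F) (auto simp: exts_def h_def numeral_2_eq_2)
  qed
  \<comment> \<open>Writing the weight of a pair as 1, plus \<open>y - 1\<close> if it is
    distinguished, reduces the sum to the \<open>h * h\<close> pairs and the \<open>h\<close>
    distinguished ones.\<close>
  have "(\<Sum>(i, v)\<in>src n R \<times> tgt n R. F {(i, ?N), (?N, v)}) =
      (\<Sum>p\<in>src n R \<times> tgt n R. ?w * x * g (h - 1) * (1 + (if p \<in> S n R then y - 1 else 0)))"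
    by (intro sum.cong) (auto simp: F4)
  also have "\<dots> = ?w * x * g (h - 1) * (of_nat (h * h) + of_nat h * (y - 1))"
    using sub by (simp add: sum_distrib_left[symmetric] sum.distrib card_h card_S
        sum.If_cases Int_absorb1 Int_def[symmetric])
  finally have F5: "(\<Sum>(i, v)\<in>src n R \<times> tgt n R. F {(i, ?N), (?N, v)}) =
      ?w * x * g (h - 1) * (of_nat (h * h) + of_nat h * (y - 1))" .
  have "(\<Sum>X\<in>exts n R. F X) = ?w * g (Suc h) + ?w * g h + of_nat h * (?w * x * g h)
      + of_nat h * (?w * g h) + ?w * x * g (h - 1) * (of_nat (h * h) + of_nat h * (y - 1))"
    unfolding sum_exts F5 F0 F1 by (simp add: F2 F3 card_h)
  also have "\<dots> = ?w * (g (Suc h) + (1 + of_nat h * (1 + x)) * g h +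
       x * of_nat h * (of_nat h - 1 + y) * g (h - 1))"
    by (simp add: algebra_simps)
  finally show "(\<Sum>X\<in>exts n R. weight x y S (R \<union> X) * g (?N - card (R \<union> X))) =
     ?w * (g (Suc (n - card R)) + (1 + of_nat (n - card R) * (1 + x)) * g (n - card R) +
       x * of_nat (n - card R) * (of_nat (n - card R) - 1 + y) * g (n - card R - 1))"
    by (simp add: F_def h_def)
qed

text \<open>This is the sum \<open>W(n, h)\<close> over partial injections with \<open>h\<close>
  sources. In the last coefficient, the square of \<open>h + 1\<close> counts the pairs available,
  of which \<open>h + 1\<close> carry \<open>y\<close>; the total is
  \<open>(h + 1) (h + y)\<close>.\<close>

fun hole_poly :: "'a :: comm_ring_1 \<Rightarrow> 'a \<Rightarrow> nat \<Rightarrow> nat \<Rightarrow> 'a" where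
  "hole_poly x y 0 h = (if h = 0 then 1 else 0)"
| "hole_poly x y (Suc n) h = (if h = 0 then 0 else hole_poly x y n (h - 1)) +
     (1 + of_nat h * (1 + x)) * hole_poly x y n h +
     x * of_nat (Suc h) * (of_nat h + y) * hole_poly x y n (Suc h)"

text \<open>With the indicator of \<open>h\<close> as \<open>g\<close>,
  \<open>sum_weight_Suc\<close> becomes the defining recurrence of \<open>hole_poly\<close>.\<close>

lemma sum_weight_eq_hole_poly:
  assumes S: "closing_rule S"
  shows "(\<Sum>R\<in>partial_inj n. weight x y S R * (if n - card R = h then 1 else 0)) = hole_poly x y n h"
proof (induction n arbitrary: h)
  case 0
  have "partial_inj 0 = {{}}" by (auto simp: partial_inj_def)
  then show ?case by (simp add: weight_def excs_def closers_def)
next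
  case (Suc n)
  let ?d = "\<lambda>h R. if n - card R = h then 1 else (0::'a)"
  have lin: "(\<Sum>R\<in>partial_inj n. weight x y S R * (a R + c * b R + d * e R)) =
      (\<Sum>R\<in>partial_inj n. weight x y S R * a R) + c * (\<Sum>R\<in>partial_inj n. weight x y S R * b R) +
      d * (\<Sum>R\<in>partial_inj n. weight x y S R * e R)" for a b e c d
    by (simp add: sum_distrib_left sum.distrib algebra_simps)
  \<comment> \<open>The coefficients are expressed by the old number \<open>m\<close> of sources; on
    the support of each indicator they can be rewritten by the new number \<open>h\<close>.\<close>
  have key: "(if Suc m = h then 1 else 0) + (1 + of_nat m * (1 + x)) * (if m = h then 1 else 0) +
       x * of_nat m * (of_nat m - 1 + y) * (if m - 1 = h then 1 else 0) =
      (if h = 0 then 0 else if m = h - 1 then 1 else 0) +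
       (1 + of_nat h * (1 + x)) * (if m = h then 1 else 0) +
       x * of_nat (Suc h) * (of_nat h + y) * (if m = Suc h then 1 else (0::'a))" for m
    by (cases m; cases h) auto
  have "(\<Sum>R\<in>partial_inj (Suc n). weight x y S R * (if Suc n - card R = h then 1 else 0)) =
    (\<Sum>R\<in>partial_inj n. weight x y S R *
      ((if Suc (n - card R) = h then 1 else 0) +
       (1 + of_nat (n - card R) * (1 + x)) * ?d h R +
       x * of_nat (n - card R) * (of_nat (n - card R) - 1 + y) * (if n - card R - 1 = h then 1 else 0)))"
    by (rule sum_weight_Suc[OF S, where g = "\<lambda>m. if m = h then 1 else 0"])
  also have "\<dots> = (\<Sum>R\<in>partial_inj n. weight x y S R *
      ((if h = 0 then 0 else ?d (h - 1) R) + (1 + of_nat h * (1 + x)) * ?d h R +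
       x * of_nat (Suc h) * (of_nat h + y) * ?d (Suc h) R))"
    by (simp only: key)
  also have "\<dots> = (if h = 0 then 0 else (\<Sum>R\<in>partial_inj n. weight x y S R * ?d (h - 1) R)) +
     (1 + of_nat h * (1 + x)) * (\<Sum>R\<in>partial_inj n. weight x y S R * ?d h R) +
     x * of_nat (Suc h) * (of_nat h + y) * (\<Sum>R\<in>partial_inj n. weight x y S R * ?d (Suc h) R)"
    unfolding lin by simp
  finally show ?case by (simp only: Suc.IH hole_poly.simps)
qed

section \<open>Excedance statistics of permutations\<close>

definition graph :: "nat \<Rightarrow> (nat \<Rightarrow> nat) \<Rightarrow> (nat \<times> nat) set" where
  "graph n \<sigma> = (\<lambda>i. (i, \<sigma> i)) ` {1..n}"

lemma graph_iff: "(i, v) \<in> graph n \<sigma> \<longleftrightarrow> 1 \<le> i \<and> i \<le> n \<and> v = \<sigma> i"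
  by (auto simp: graph_def)

lemma permutes_le_iff:
  assumes "\<sigma> permutes {1..n}"
  shows "1 \<le> \<sigma> i \<longleftrightarrow> 1 \<le> i" "\<sigma> i \<le> n \<longleftrightarrow> i \<le> n"
proof -
  have *: "\<sigma> i \<in> {1..n} \<longleftrightarrow> i \<in> {1..n}" using assms by (rule permutes_in_image)
  show "1 \<le> \<sigma> i \<longleftrightarrow> 1 \<le> i" "\<sigma> i \<le> n \<longleftrightarrow> i \<le> n"
    using * permutes_not_in[OF assms, of i] by (cases "i \<in> {1..n}"; auto)+
qed

lemma graph_iff': "\<sigma> permutes {1..n} \<Longrightarrow> (i, v) \<in> graph n \<sigma> \<longleftrightarrow> 1 \<le> v \<and> v \<le> n \<and> i = inv \<sigma> v"
  using permutes_le_iff[of \<sigma> n i] by (auto simp: graph_iff permutes_inv_eq permutes_inverses)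

text \<open>A partial injection with \<open>n\<close> pairs has no source left, so it is a total
  injective map of a finite set into itself, hence a permutation.\<close>

lemma bij_betw_graph:
  "bij_betw (graph n) {\<sigma>. \<sigma> permutes {1..n}} {R \<in> partial_inj n. card R = n}"
proof -
  have "inj_on (graph n) {\<sigma>. \<sigma> permutes {1..n}}"
  proof (rule inj_onI)
    fix \<sigma> \<tau> assume "\<sigma> \<in> {\<sigma>. \<sigma> permutes {1..n}}" "\<tau> \<in> {\<sigma>. \<sigma> permutes {1..n}}"
      and eq: "graph n \<sigma> = graph n \<tau>"
    then have p: "\<sigma> permutes {1..n}" "\<tau> permutes {1..n}" by auto
    show "\<sigma> = \<tau>"
    proof
      fix i show "\<sigma> i = \<tau> i"
      proof (cases "i \<in> {1..n}")
        case True
        then have "(i, \<sigma> i) \<in> graph n \<tau>" unfolding eq[symmetric] by (simp add: graph_iff)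
        then show ?thesis by (simp add: graph_iff)
      qed (simp add: permutes_not_in[OF p(1)] permutes_not_in[OF p(2)])
    qed
  qed
  moreover have "graph n \<sigma> \<in> {R \<in> partial_inj n. card R = n}" if "\<sigma> permutes {1..n}" for \<sigma>
  proof -
    have "graph n \<sigma> \<in> partial_inj n"
      using permutes_le_iff[OF that] permutes_inj[OF that]
      by (intro partial_injI) (auto simp: graph_iff inj_def)
    moreover have "card (graph n \<sigma>) = n"
      unfolding graph_def by (subst card_image) (auto simp: inj_on_def)
    ultimately show ?thesis by simp
  qed
  moreover have "R \<in> graph n ` {\<sigma>. \<sigma> permutes {1..n}}" if R: "R \<in> partial_inj n" "card R = n" for R
  proof -
    have "card (src n R) = 0" using card_src[OF R(1)] R(2) by simp
    then have "\<forall>i\<in>{1..n}. \<exists>v. (i, v) \<in> R" by (auto simp: src_def)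
    then obtain f where f: "\<And>i. i \<in> {1..n} \<Longrightarrow> (i, f i) \<in> R" by metis
    define \<sigma> where "\<sigma> i = (if i \<in> {1..n} then f i else i)" for i
    have "inj_on \<sigma> {1..n}"
      using f partial_injD(4)[OF R(1)] by (intro inj_onI) (metis \<sigma>_def)
    moreover have "\<sigma> ` {1..n} \<subseteq> {1..n}"
    proof (rule image_subsetI)
      fix i assume i: "i \<in> {1..n}"
      show "\<sigma> i \<in> {1..n}" using partial_injD(2)[OF R(1) f[OF i]] i by (simp add: \<sigma>_def)
    qed
    ultimately have "bij_betw \<sigma> {1..n} {1..n}"
      by (simp add: bij_betw_def endo_inj_surj)
    then have p: "\<sigma> permutes {1..n}"
      by (rule bij_imp_permutes) (auto simp: \<sigma>_def)
    have "graph n \<sigma> \<subseteq> R" using f by (auto simp: graph_def \<sigma>_def)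
    moreover have "card (graph n \<sigma>) = n"
      unfolding graph_def by (subst card_image) (auto simp: inj_on_def)
    ultimately have "graph n \<sigma> = R"
      using R partial_inj_finite by (simp add: card_subset_eq)
    with p show ?thesis by blast
  qed
  ultimately show ?thesis by (auto simp: bij_betw_def)
qed

text \<open>Permutations are the final states without sources, that is, \<open>h = 0\<close>. The
  result does not depend on the closing rule \<open>S\<close>.\<close>

lemma sum_weight_permutes:
  fixes x y :: "'a :: comm_ring_1"
  assumes S: "closing_rule S"
  shows "(\<Sum>\<sigma> | \<sigma> permutes {1..n}. weight x y S (graph n \<sigma>)) = hole_poly x y n 0"
proof -
  have eq: "{R \<in> partial_inj n. card R = n} = {R \<in> partial_inj n. n - card R = 0}"
    using card_partial_inj_le by force
  have "(\<Sum>\<sigma> | \<sigma> permutes {1..n}. weight x y S (graph n \<sigma>)) =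
      (\<Sum>R | R \<in> partial_inj n \<and> card R = n. weight x y S R)"
    by (rule sum.reindex_bij_betw[OF bij_betw_graph])
  also have "\<dots> = (\<Sum>R\<in>partial_inj n. weight x y S R * (if n - card R = 0 then 1 else 0))"
    unfolding eq sum.inter_filter[OF finite_partial_inj] by (intro sum.cong refl) simp
  finally show ?thesis by (simp only: sum_weight_eq_hole_poly[OF S])
qed

lemma card_excs_graph: "card (excs (graph n \<sigma>)) = exc n \<sigma>"
proof -
  have "excs (graph n \<sigma>) = (\<lambda>i. (i, \<sigma> i)) ` {i \<in> {1..n}. \<sigma> i > i}"
    by (auto simp: excs_def graph_def)
  then show ?thesis by (simp add: exc_def card_image inj_on_def)
qed

lemma restr_graph_iff:
  assumes "\<sigma> permutes {1..n}" "m \<le> n"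
  shows "(i, v) \<in> restr m (graph n \<sigma>) \<longleftrightarrow> i \<in> {1..m} \<and> v = \<sigma> i \<and> \<sigma> i \<le> m"
    and "(i, v) \<in> restr m (graph n \<sigma>) \<longleftrightarrow> v \<in> {1..m} \<and> i = inv \<sigma> v \<and> inv \<sigma> v \<le> m"
proof -
  show "(i, v) \<in> restr m (graph n \<sigma>) \<longleftrightarrow> i \<in> {1..m} \<and> v = \<sigma> i \<and> \<sigma> i \<le> m"
    using assms(2) permutes_le_iff(1)[OF assms(1), of i] by (auto simp: restr_def graph_iff)
  show "(i, v) \<in> restr m (graph n \<sigma>) \<longleftrightarrow> v \<in> {1..m} \<and> i = inv \<sigma> v \<and> inv \<sigma> v \<le> m"
    using assms(2) permutes_le_iff(1)[OF permutes_inv[OF assms(1)], of v]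
    by (auto simp: restr_def graph_iff'[OF assms(1)])
qed

lemma src_restr_graph:
  assumes "\<sigma> permutes {1..n}" "m \<le> n"
  shows "src m (restr m (graph n \<sigma>)) = {i \<in> {1..m}. m < \<sigma> i}"
  by (rule set_eqI, unfold src_iff restr_graph_iff(1)[OF assms]) auto

lemma tgt_restr_graph:
  assumes "\<sigma> permutes {1..n}" "m \<le> n"
  shows "tgt m (restr m (graph n \<sigma>)) = {v \<in> {1..m}. m < inv \<sigma> v}"
  by (rule set_eqI, unfold tgt_iff restr_graph_iff(2)[OF assms]) auto

lemma closers_graph:
  assumes "\<sigma> permutes {1..n}"
  shows "closers S (graph n \<sigma>) = {k \<in> {1..n}. inv \<sigma> k < k \<and> \<sigma> k < k \<and>
    (inv \<sigma> k, \<sigma> k) \<in> S (k - 1) (restr (k - 1) (graph n \<sigma>))}"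
proof (rule set_eqI)
  fix k
  show "k \<in> closers S (graph n \<sigma>) \<longleftrightarrow> k \<in> {k \<in> {1..n}. inv \<sigma> k < k \<and> \<sigma> k < k \<and>
      (inv \<sigma> k, \<sigma> k) \<in> S (k - 1) (restr (k - 1) (graph n \<sigma>))}"
    unfolding closers_def mem_Collect_eq graph_iff[of k] graph_iff'[OF assms, of _ k] by auto
qed

section \<open>Three closing rules and the statistics they count\<close>

definition ear_rule :: "nat \<Rightarrow> (nat \<times> nat) set \<Rightarrow> (nat \<times> nat) set" where
  "ear_rule n R = {(i, v) \<in> src n R \<times> tgt n R. \<forall>w\<in>tgt n R. v \<le> w}"

definition pex_rule :: "nat \<Rightarrow> (nat \<times> nat) set \<Rightarrow> (nat \<times> nat) set" where
  "pex_rule n R = {(i, v) \<in> src n R \<times> tgt n R. \<forall>j\<in>src n R. j \<le> i}"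

text \<open>The pair consists of the two ends of one path of \<open>R\<close>, so linking both ends
  to the new point closes that path into a cycle whose maximum is the new point.\<close>

definition pcyc_rule :: "nat \<Rightarrow> (nat \<times> nat) set \<Rightarrow> (nat \<times> nat) set" where
  "pcyc_rule n R = {(i, v) \<in> src n R \<times> tgt n R. (v, i) \<in> R\<^sup>*}"

text \<open>The target is forced to be the least one and the source is free, which leaves one pair
  per source.\<close>

lemma closing_rule_ear: "closing_rule ear_rule"
  unfolding closing_rule_def
proof (intro allI ballI conjI)
  fix n R assume R: "R \<in> partial_inj n"
  show "ear_rule n R \<subseteq> src n R \<times> tgt n R" by (auto simp: ear_rule_def)
  show "card (ear_rule n R) = n - card R"
  proof (cases "tgt n R = {}")
    case True
    then show ?thesis using card_tgt[OF R] by (simp add: ear_rule_def)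
  next
    case False
    then have "ear_rule n R = src n R \<times> {v. v = Min (tgt n R)}"
      unfolding ear_rule_def by (auto simp: eq_Min_iff)
    then show ?thesis using card_src[OF R] by (simp add: card_cartesian_product)
  qed
qed

text \<open>Here the source is forced to be the largest one and the target is free.\<close>

lemma closing_rule_pex: "closing_rule pex_rule"
  unfolding closing_rule_def
proof (intro allI ballI conjI)
  fix n R assume R: "R \<in> partial_inj n"
  show "pex_rule n R \<subseteq> src n R \<times> tgt n R" by (auto simp: pex_rule_def)
  show "card (pex_rule n R) = n - card R"
  proof (cases "src n R = {}")
    case True
    then show ?thesis using card_src[OF R] by (simp add: pex_rule_def)
  next
    case False
    then have "pex_rule n R = {i. i = Max (src n R)} \<times> tgt n R"
      unfolding pex_rule_def by (auto simp: eq_Max_iff)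
    then show ?thesis using card_tgt[OF R] by (simp add: card_cartesian_product)
  qed
qed

text \<open>The source \<open>i\<close> ends a path of \<open>R\<close>. Walking backwards is
  deterministic and cannot loop, since \<open>i\<close> has no image; it stops at the start of the
  path.\<close>

lemma ex1_source:
  assumes R: "R \<in> partial_inj n" and i: "i \<in> src n R"
  shows "\<exists>!v. v \<in> tgt n R \<and> (v, i) \<in> R\<^sup>*"
proof -
  define A where "A = {a. (a, i) \<in> R\<^sup>*}"
  have A_sub: "A \<subseteq> {1..n}"
  proof
    fix a assume "a \<in> A"
    then have "a = i \<or> (\<exists>b. (a, b) \<in> R)"
      by (auto simp: A_def elim: converse_rtranclE)
    then show "a \<in> {1..n}"
      using i partial_injD(1)[OF R, of a] by (auto simp: src_def)
  qed
  then have fin: "finite A" by (rule finite_subset) simp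
  have iA: "i \<in> A" by (simp add: A_def)
  \<comment> \<open>If every point of \<open>A\<close> had a preimage, choosing preimages would
    inject the finite set \<open>A\<close> into \<open>A - {i}\<close>.\<close>
  have "\<not> A \<subseteq> Range R"
  proof
    assume "A \<subseteq> Range R"
    then have "\<forall>a\<in>A. \<exists>b. (b, a) \<in> R" by blast
    then obtain p where p: "\<And>a. a \<in> A \<Longrightarrow> (p a, a) \<in> R" by metis
    have "inj_on p A"
    proof (rule inj_onI)
      fix a b assume "a \<in> A" "b \<in> A" "p a = p b"
      then show "a = b" using p[of a] p[of b] partial_injD(3)[OF R, of "p a" a b] by simp
    qed
    moreover have "p ` A \<subseteq> A - {i}"
    proof (rule image_subsetI)
      fix a assume a: "a \<in> A"
      then have "(p a, i) \<in> R\<^sup>*"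
        using p[OF a] unfolding A_def by (auto intro: converse_rtrancl_into_rtrancl)
      moreover have "p a \<noteq> i" using p[OF a] i by (auto simp: src_def)
      ultimately show "p a \<in> A - {i}" by (simp add: A_def)
    qed
    ultimately have "card A \<le> card (A - {i})" using fin by (intro card_inj_on_le) auto
    moreover have "card (A - {i}) < card A" using fin iA by (rule card_Diff1_less)
    ultimately show False by simp
  qed
  then obtain v where v: "v \<in> A" "v \<notin> Range R" by blast
  \<comment> \<open>Since preimages are unique, two points that reach a common point lie on one
    path. This yields uniqueness of the starting point.\<close>
  have conf: "(a, b) \<in> R\<^sup>* \<or> (b, a) \<in> R\<^sup>*" if "(a, c) \<in> R\<^sup>*" "(b, c) \<in> R\<^sup>*" for a b c
    using that
  proof (induction arbitrary: b rule: rtrancl_induct)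
    case (step c d)
    note IH = step.IH and cd = step.hyps(2)
    from step.prems show ?case
    proof (cases rule: rtranclE)
      case base
      have "(a, d) \<in> R\<^sup>*" using step.hyps by (rule rtrancl_into_rtrancl)
      with base show ?thesis by simp
    next
      case (step e)
      have "e = c" using partial_injD(4)[OF R step(2)] cd by blast
      with step(1) show ?thesis using IH by blast
    qed
  qed auto
  show ?thesis
  proof (rule ex1I[of _ v])
    show "v \<in> tgt n R \<and> (v, i) \<in> R\<^sup>*" using v A_sub by (auto simp: tgt_def A_def)
    fix w assume w: "w \<in> tgt n R \<and> (w, i) \<in> R\<^sup>*"
    then have "w \<notin> Range R" by (simp add: tgt_def)
    moreover have "(v, w) \<in> R\<^sup>* \<or> (w, v) \<in> R\<^sup>*"
      using conf v(1) w unfolding A_def by blast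
    ultimately show "w = v" using v(2) by (auto elim: rtranclE)
  qed
qed

lemma closing_rule_pcyc: "closing_rule pcyc_rule"
  unfolding closing_rule_def
proof (intro allI ballI conjI)
  fix n R assume R: "R \<in> partial_inj n"
  show "pcyc_rule n R \<subseteq> src n R \<times> tgt n R" by (auto simp: pcyc_rule_def)
  obtain f where f: "\<And>i v. i \<in> src n R \<Longrightarrow> v \<in> tgt n R \<and> (v, i) \<in> R\<^sup>* \<longleftrightarrow> v = f i"
    using ex1_source[OF R] by metis
  have "pcyc_rule n R = (\<lambda>i. (i, f i)) ` src n R"
    using f by (auto simp: pcyc_rule_def)
  then show "card (pcyc_rule n R) = n - card R"
    using card_src[OF R] by (simp add: card_image inj_on_def)
qed

text \<open>At a cycle peak \<open>k\<close> the open targets are the values below \<open>k\<close>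
  taken at positions from \<open>k\<close> on. That \<open>\<sigma> k\<close> is the least of them
  is the antirecord condition, because values of at least \<open>k\<close> exceed
  \<open>\<sigma> k\<close> anyway.\<close>

lemma closers_ear:
  assumes p: "\<sigma> permutes {1..n}"
  shows "closers ear_rule (graph n \<sigma>) =
    {i \<in> {1..n}. is_exclusive_antirecord n \<sigma> i \<and> is_cycle_peak n \<sigma> i}"
proof -
  have "(inv \<sigma> k, \<sigma> k) \<in> ear_rule (k - 1) (restr (k - 1) (graph n \<sigma>)) \<longleftrightarrow>
      is_exclusive_antirecord n \<sigma> k"
    if k: "k \<in> {1..n}" "inv \<sigma> k < k" "\<sigma> k < k" for k
  proof -
    note le = permutes_le_iff[OF p] permutes_le_iff[OF permutes_inv[OF p]]
    note inv = permutes_inverses[OF p]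
    have m: "k - 1 \<le> n" using k by simp
    have pos: "1 \<le> \<sigma> k" "1 \<le> inv \<sigma> k" using k(1) unfolding le by simp_all
    have "(inv \<sigma> k, \<sigma> k) \<in> ear_rule (k - 1) (restr (k - 1) (graph n \<sigma>)) \<longleftrightarrow>
        (\<forall>w. 1 \<le> w \<longrightarrow> w < k \<longrightarrow> k \<le> inv \<sigma> w \<longrightarrow> \<sigma> k \<le> w)"
      unfolding ear_rule_def src_restr_graph[OF p m] tgt_restr_graph[OF p m]
      using k pos by (auto simp: inv)
    also have "\<dots> \<longleftrightarrow> is_antirecord n \<sigma> k"
    proof
      assume *: "\<forall>w. 1 \<le> w \<longrightarrow> w < k \<longrightarrow> k \<le> inv \<sigma> w \<longrightarrow> \<sigma> k \<le> w"
      have "\<sigma> k < \<sigma> j" if j: "j \<in> {k<..n}" for j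
      proof (cases "\<sigma> j < k")
        case True
        have "1 \<le> \<sigma> j" using j unfolding le by simp
        then have "\<sigma> k \<le> \<sigma> j" using *[rule_format, of "\<sigma> j"] True j by (simp add: inv)
        moreover have "\<sigma> k \<noteq> \<sigma> j" using j permutes_inj[OF p] by (auto simp: inj_def)
        ultimately show ?thesis by simp
      qed (use k in simp)
      with k show "is_antirecord n \<sigma> k" by (simp add: is_antirecord_def)
    next
      assume *: "is_antirecord n \<sigma> k"
      show "\<forall>w. 1 \<le> w \<longrightarrow> w < k \<longrightarrow> k \<le> inv \<sigma> w \<longrightarrow> \<sigma> k \<le> w"
      proof (intro allI impI)
        fix w assume w: "1 \<le> w" "w < k" "k \<le> inv \<sigma> w"
        show "\<sigma> k \<le> w"
        proof (cases "k = inv \<sigma> w")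
          case False
          then have "inv \<sigma> w \<in> {k<..n}" using w k le by simp
          with * have "\<sigma> k < \<sigma> (inv \<sigma> w)" by (simp add: is_antirecord_def)
          then show ?thesis by (simp add: inv)
        qed (simp add: inv)
      qed
    qed
    also have "\<dots> \<longleftrightarrow> is_exclusive_antirecord n \<sigma> k"
    proof -
      \<comment> \<open>A record at \<open>k\<close> would force an injection of
        \<open>{1..k}\<close> into \<open>{1..\<sigma> k}\<close>, impossible when
        \<open>\<sigma> k < k\<close>; so exclusivity is automatic here.\<close>
      have "\<not> is_record n \<sigma> k"
      proof
        assume "is_record n \<sigma> k"
        then have "\<sigma> ` {1..k} \<subseteq> {1..\<sigma> k}"
          using le by (fastforce simp: is_record_def le_less)
        then have "card {1..k} \<le> card {1..\<sigma> k}"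
          using permutes_inj[OF p] by (intro card_inj_on_le[of \<sigma>]) (auto simp: inj_on_def inj_def)
        with k(3) show False by simp
      qed
      then show ?thesis by (simp add: is_exclusive_antirecord_def)
    qed
    finally show ?thesis .
  qed
  then show ?thesis
    unfolding closers_graph[OF p] is_cycle_peak_def by blast
qed

text \<open>A path from \<open>\<sigma> k\<close> to \<open>inv \<sigma> k\<close> through points
  below \<open>k\<close> exists exactly when \<open>k\<close> is the maximum of its nontrivial
  cycle.\<close>

lemma closers_pcyc:
  assumes p: "\<sigma> permutes {1..n}"
  shows "closers pcyc_rule (graph n \<sigma>) =
    {k \<in> {1..n}. \<sigma> k \<noteq> k \<and> (\<forall>j\<in>Orbits.orbit \<sigma> k. j \<le> k)}"
proof -
  note le = permutes_le_iff[OF p] permutes_le_iff[OF permutes_inv[OF p]]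
  note inv = permutes_inverses[OF p]
  have "(inv \<sigma> k < k \<and> \<sigma> k < k \<and> (inv \<sigma> k, \<sigma> k) \<in> pcyc_rule (k - 1) (restr (k - 1) (graph n \<sigma>))) \<longleftrightarrow>
      (\<sigma> k \<noteq> k \<and> (\<forall>j\<in>Orbits.orbit \<sigma> k. j \<le> k))" (is "?L \<longleftrightarrow> ?R") if k: "k \<in> {1..n}" for k
  proof -
    have m: "k - 1 \<le> n" using k by auto
    have pos: "1 \<le> \<sigma> k" "1 \<le> inv \<sigma> k" using k unfolding le by simp_all
    let ?Q = "restr (k - 1) (graph n \<sigma>)"
    show ?thesis
    proof
      assume L: ?L
      then have path: "(\<sigma> k, inv \<sigma> k) \<in> ?Q\<^sup>*" by (simp add: pcyc_rule_def)
      \<comment> \<open>Invariant along the orbit: each point other than \<open>k\<close> still has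
        a path below \<open>k\<close> to \<open>inv \<sigma> k\<close>, whose first step is the next
        orbit point; after \<open>inv \<sigma> k\<close> comes \<open>k\<close>.\<close>
      have "j \<le> k \<and> (j = k \<or> (j, inv \<sigma> k) \<in> ?Q\<^sup>*)" if "j \<in> Orbits.orbit \<sigma> k" for j
        using that
      proof induction
        case base
        then show ?case using L path by simp
      next
        case (step j)
        show ?case
        proof (cases "j = k")
          case True
          then show ?thesis using L path by simp
        next
          case False
          then have "(j, inv \<sigma> k) \<in> ?Q\<^sup>*" using step.IH by simp
          then show ?thesis
          proof (cases rule: converse_rtranclE)
            case base
            then show ?thesis by (simp add: inv)
          next
            case (step b)
            then have "b = \<sigma> j" "\<sigma> j \<le> k - 1" using restr_graph_iff(1)[OF p m, of j b] by auto
            with step(2) show ?thesis by auto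
          qed
        qed
      qed
      with L show ?R by auto
    next
      assume R: ?R
      then have lt: "\<sigma> k < k" using orbit.base[of \<sigma> k] by (meson le_neq_implies_less)
      \<comment> \<open>The inductive orbit starts at \<open>\<sigma> k\<close>, so membership of
        the predecessor of \<open>k\<close> relies on \<open>\<sigma>\<close> being a permutation
        with finite support.\<close>
      have ik: "inv \<sigma> k \<in> Orbits.orbit \<sigma> k"
      proof (rule orbit_swap)
        show "inv \<sigma> k \<in> Orbits.orbit \<sigma> (inv \<sigma> k)"
          using p by (intro permutation_self_in_orbit) (auto simp: permutation_permutes)
        show "k \<in> Orbits.orbit \<sigma> (inv \<sigma> k)" using orbit.base[of \<sigma> "inv \<sigma> k"] by (simp add: inv)
      qed
      have "inv \<sigma> k \<noteq> k" using R inv(1)[of k] by auto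
      then have lt': "inv \<sigma> k < k" using R ik by (meson le_neq_implies_less)
      \<comment> \<open>The path is built forwards from \<open>\<sigma> k\<close>; an arc leaves
        \<open>?Q\<close> only if it touches \<open>k\<close>.\<close>
      have "j = k \<or> (\<sigma> k, j) \<in> ?Q\<^sup>*" if "j \<in> Orbits.orbit \<sigma> k" for j
        using that
      proof induction
        case (step j)
        show ?case
        proof (cases "j = k \<or> \<sigma> j = k")
          case False
          have "j \<le> k" "\<sigma> j \<le> k" using R step.hyps orbit.step[OF step.hyps] by auto
          moreover have "1 \<le> j"
            using step.hyps k le(1) by (induction) auto
          ultimately have "(j, \<sigma> j) \<in> ?Q" using False restr_graph_iff(1)[OF p m, of j "\<sigma> j"] by auto
          with False step.IH show ?thesis by (meson rtrancl.rtrancl_into_rtrancl)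
        qed auto
      qed auto
      then have "(\<sigma> k, inv \<sigma> k) \<in> ?Q\<^sup>*" using ik \<open>inv \<sigma> k \<noteq> k\<close> by blast
      then have "(inv \<sigma> k, \<sigma> k) \<in> pcyc_rule (k - 1) ?Q"
        unfolding pcyc_rule_def src_restr_graph[OF p m] tgt_restr_graph[OF p m]
        using k lt lt' pos by (auto simp: inv)
      with lt lt' show ?L by simp
    qed
  qed
  then show ?thesis unfolding closers_graph[OF p] by blast
qed

text \<open>Each cycle is represented by its maximum, collected in \<open>M\<close>; removing the
  fixed points leaves the maxima of the nontrivial cycles.\<close>

lemma card_closers_pcyc:
  assumes p: "\<sigma> permutes {1..n}"
  shows "card (closers pcyc_rule (graph n \<sigma>)) = pcyc n \<sigma>"
proof -
  define M where "M = {k \<in> {1..n}. \<forall>j\<in>Orbits.orbit \<sigma> k. j \<le> k}"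
  have perm: "permutation \<sigma>" using p by (auto simp: permutation_permutes)
  have self: "k \<in> Orbits.orbit \<sigma> k" for k by (rule permutation_self_in_orbit[OF perm])
  have orbit_eq: "Orbits.orbit \<sigma> j = Orbits.orbit \<sigma> k" if "j \<in> Orbits.orbit \<sigma> k" for j k
    using orbit_swap[OF self that] that by (meson orbit_trans subset_antisym subsetI)
  have sub: "Orbits.orbit \<sigma> k \<subseteq> {1..n}" if "k \<in> {1..n}" for k
    using permutes_orbit_subset[OF p that] .
  have "inj_on (Orbits.orbit \<sigma>) M"
    using self by (intro inj_onI) (metis (no_types, lifting) M_def le_antisym mem_Collect_eq)
  moreover have "Orbits.orbit \<sigma> ` M = Orbits.orbit \<sigma> ` {1..n}"
  proof (intro subset_antisym image_subsetI)
    fix i assume i: "i \<in> {1..n}"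
    let ?k = "Max (Orbits.orbit \<sigma> i)"
    have fin: "finite (Orbits.orbit \<sigma> i)" using sub[OF i] by (rule finite_subset) simp
    have k: "?k \<in> Orbits.orbit \<sigma> i" using fin self[of i] by (intro Max_in) auto
    have "?k \<in> M" using k sub[OF i] fin by (auto simp: M_def orbit_eq[OF k])
    then show "Orbits.orbit \<sigma> i \<in> Orbits.orbit \<sigma> ` M" using orbit_eq[OF k] by (metis imageI)
  qed (auto simp: M_def)
  ultimately have "cyc n \<sigma> = card M" unfolding cyc_def by (metis card_image)
  moreover have "{i \<in> {1..n}. \<sigma> i = i} \<subseteq> M"
  proof
    fix i assume "i \<in> {i \<in> {1..n}. \<sigma> i = i}"
    then show "i \<in> M" using orbit_eq_singleton_iff[of \<sigma> i] by (auto simp: M_def)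
  qed
  moreover have "closers pcyc_rule (graph n \<sigma>) = M - {i \<in> {1..n}. \<sigma> i = i}"
    unfolding closers_pcyc[OF p] by (auto simp: M_def)
  ultimately show ?thesis by (simp add: pcyc_def fixpts_def card_Diff_subset)
qed

section \<open>Reversal of the inverse, and \<open>pex\<close>\<close>

definition reflect :: "nat \<Rightarrow> nat \<Rightarrow> nat" where
  "reflect n i = (if i \<in> {1..n} then Suc n - i else i)"

lemma reflect_reflect [simp]: "reflect n (reflect n i) = i"
  by (auto simp: reflect_def)

lemma reflect_permutes: "reflect n permutes {1..n}"
  by (rule bij_imp_permutes, rule bij_betw_byWitness[where f' = "reflect n"])
     (auto simp: reflect_def)

lemma reflect_less_iff:
  "i \<in> {1..n} \<Longrightarrow> j \<in> {1..n} \<Longrightarrow> reflect n i < reflect n j \<longleftrightarrow> j < i"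
  by (auto simp: reflect_def)

lemma reflect_le_iff:
  "i \<in> {1..n} \<Longrightarrow> j \<in> {1..n} \<Longrightarrow> reflect n i \<le> reflect n j \<longleftrightarrow> j \<le> i"
  by (auto simp: reflect_def)

lemma reflect_in: "i \<in> {1..n} \<Longrightarrow> reflect n i \<in> {1..n}"
  by (auto simp: reflect_def)

text \<open>An arc from \<open>i\<close> to \<open>j\<close> becomes an arc from
  \<open>reflect n j\<close> to \<open>reflect n i\<close>. Reversing both the direction and the
  order keeps excedances, while cycle valleys become cycle peaks.\<close>

definition reverse_inv :: "nat \<Rightarrow> (nat \<Rightarrow> nat) \<Rightarrow> nat \<Rightarrow> nat" where
  "reverse_inv n \<sigma> = reflect n \<circ> inv \<sigma> \<circ> reflect n"

lemma reverse_inv_permutes: "\<sigma> permutes {1..n} \<Longrightarrow> reverse_inv n \<sigma> permutes {1..n}"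
  unfolding reverse_inv_def by (intro permutes_compose reflect_permutes permutes_inv)

lemma inv_reverse_inv:
  assumes "\<sigma> permutes {1..n}"
  shows "inv (reverse_inv n \<sigma>) = reflect n \<circ> \<sigma> \<circ> reflect n"
  by (rule inv_unique_comp) (auto simp: fun_eq_iff reverse_inv_def permutes_inverses[OF assms])

lemma reverse_inv_reverse_inv:
  assumes "\<sigma> permutes {1..n}"
  shows "reverse_inv n (reverse_inv n \<sigma>) = \<sigma>"
  unfolding reverse_inv_def[of n "reverse_inv n \<sigma>"] inv_reverse_inv[OF assms]
  by (simp add: fun_eq_iff)

text \<open>The excedance at \<open>i\<close> corresponds to the one at
  \<open>reflect n (\<sigma> i)\<close>, the new tail of its arc.\<close>

lemma exc_reverse_inv:
  assumes p: "\<sigma> permutes {1..n}"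
  shows "exc n (reverse_inv n \<sigma>) = exc n \<sigma>"
proof -
  let ?f = "\<lambda>i. reflect n (\<sigma> i)"
  have "{i \<in> {1..n}. reverse_inv n \<sigma> i > i} = ?f ` {i \<in> {1..n}. \<sigma> i > i}"
  proof (intro subset_antisym subsetI)
    fix k assume k: "k \<in> {i \<in> {1..n}. reverse_inv n \<sigma> i > i}"
    define i where "i = inv \<sigma> (reflect n k)"
    have "i \<in> {1..n}" "\<sigma> i = reflect n k"
      using k reflect_in permutes_in_image[OF permutes_inv[OF p]]
      by (auto simp: i_def permutes_inverses[OF p])
    moreover from this have "reflect n (\<sigma> i) < reflect n i" using k by (simp add: reverse_inv_def i_def)
    ultimately have "i < \<sigma> i"
      using reflect_less_iff[of "\<sigma> i" n i] permutes_in_image[OF p, of i] by simp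
    with \<open>i \<in> {1..n}\<close> \<open>\<sigma> i = _\<close> show "k \<in> ?f ` {i \<in> {1..n}. \<sigma> i > i}"
      by (intro image_eqI[of _ _ i]) auto
  next
    fix k assume "k \<in> ?f ` {i \<in> {1..n}. \<sigma> i > i}"
    then obtain i where i: "i \<in> {1..n}" "\<sigma> i > i" "k = reflect n (\<sigma> i)" by auto
    then have "\<sigma> i \<in> {1..n}" using permutes_in_image[OF p] by blast
    with i reflect_less_iff[of "\<sigma> i" n i] show "k \<in> {i \<in> {1..n}. reverse_inv n \<sigma> i > i}"
      using reflect_in[of "\<sigma> i" n] by (simp add: reverse_inv_def permutes_inverses[OF p])
  qed
  moreover have "inj ?f"
    using permutes_inj[OF p] reflect_reflect by (intro injI) (metis injD)
  ultimately show ?thesis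
    by (simp add: exc_def card_image inj_on_def inj_def)
qed

text \<open>Under reflection, taking the largest source at a cycle peak turns into
  \<open>\<sigma> i\<close> being the least value above \<open>i\<close> taken at positions up to
  \<open>i\<close>, where \<open>i\<close> is a cycle valley of \<open>\<sigma>\<close>.\<close>

lemma card_closers_pex:
  assumes p: "\<sigma> permutes {1..n}"
  shows "card (closers pex_rule (graph n (reverse_inv n \<sigma>))) = pex n \<sigma>"
proof -
  let ?\<tau> = "reverse_inv n \<sigma>"
  note q = reverse_inv_permutes[OF p]
  have in_iff: "\<sigma> i \<in> {1..n} \<longleftrightarrow> i \<in> {1..n}" "inv \<sigma> i \<in> {1..n} \<longleftrightarrow> i \<in> {1..n}" for i
    using permutes_in_image[OF p] permutes_in_image[OF permutes_inv[OF p]] by auto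
  note inv = permutes_inverses[OF p]
  have key: "reflect n i \<in> closers pex_rule (graph n ?\<tau>) \<longleftrightarrow>
      \<sigma> i > i \<and> (\<forall>j\<in>{1..<i}. \<sigma> j \<notin> {i..\<sigma> i})" if i: "i \<in> {1..n}" for i
  proof -
    define k where "k = reflect n i"
    have k: "k \<in> {1..n}" and m: "k - 1 \<le> n" using reflect_in[OF i] by (auto simp: k_def)
    have inv_\<tau>: "inv ?\<tau> k = reflect n (\<sigma> i)" and \<tau>: "?\<tau> k = reflect n (inv \<sigma> i)"
      unfolding inv_reverse_inv[OF p] by (simp_all add: reverse_inv_def k_def)
    have exc_iff: "inv ?\<tau> k < k \<longleftrightarrow> i < \<sigma> i" and aexc_iff: "?\<tau> k < k \<longleftrightarrow> i < inv \<sigma> i"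
      unfolding inv_\<tau> \<tau> unfolding k_def by (rule reflect_less_iff; simp only: in_iff i)+
    have "(inv ?\<tau> k, ?\<tau> k) \<in> pex_rule (k - 1) (restr (k - 1) (graph n ?\<tau>)) \<longleftrightarrow>
        (\<forall>c\<in>{1..i}. i < \<sigma> c \<longrightarrow> \<sigma> i \<le> \<sigma> c)" if lt: "inv ?\<tau> k < k" "?\<tau> k < k"
    proof -
      have "1 \<le> inv ?\<tau> k" "1 \<le> ?\<tau> k"
        using permutes_in_image[OF q, of k] permutes_in_image[OF permutes_inv[OF q], of k] k by auto
      then have "(inv ?\<tau> k, ?\<tau> k) \<in> pex_rule (k - 1) (restr (k - 1) (graph n ?\<tau>)) \<longleftrightarrow>
          (\<forall>j\<in>{1..n}. j < k \<longrightarrow> k \<le> ?\<tau> j \<longrightarrow> j \<le> inv ?\<tau> k)"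
        unfolding pex_rule_def src_restr_graph[OF q m] tgt_restr_graph[OF q m]
        using lt k by (cases k) (auto simp: permutes_inverses[OF q] less_Suc_eq_le less_eq_Suc_le[symmetric])
      \<comment> \<open>Substitute \<open>j = reflect n (\<sigma> c)\<close>: its image under
        \<open>?\<tau>\<close> is \<open>reflect n c\<close>, and every inequality is
        reversed.\<close>
      also have "\<dots> \<longleftrightarrow> (\<forall>c\<in>{1..n}. i < \<sigma> c \<longrightarrow> c \<le> i \<longrightarrow> \<sigma> i \<le> \<sigma> c)"
      proof -
        have "(j < k \<longrightarrow> k \<le> ?\<tau> j \<longrightarrow> j \<le> inv ?\<tau> k) \<longleftrightarrow> (i < \<sigma> c \<longrightarrow> c \<le> i \<longrightarrow> \<sigma> i \<le> \<sigma> c)"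
          if "c \<in> {1..n}" "j = reflect n (\<sigma> c)" for j c
        proof -
          have "?\<tau> j = reflect n c" using that by (simp add: reverse_inv_def inv)
          moreover have "\<sigma> c \<in> {1..n}" "\<sigma> i \<in> {1..n}" using that(1) i by (simp_all only: in_iff)
          ultimately show ?thesis
            unfolding inv_\<tau> unfolding k_def using that i
            by (simp only: reflect_less_iff reflect_le_iff)
        qed
        moreover have "\<exists>c\<in>{1..n}. j = reflect n (\<sigma> c)" if "j \<in> {1..n}" for j
          using that reflect_in[OF that] by (intro bexI[of _ "inv \<sigma> (reflect n j)"]) (simp_all only: inv in_iff reflect_reflect)
        moreover have "reflect n (\<sigma> c) \<in> {1..n}" if "c \<in> {1..n}" for c
          using that by (intro reflect_in) (simp only: in_iff)
        ultimately show ?thesis by metis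
      qed
      also have "\<dots> \<longleftrightarrow> (\<forall>c\<in>{1..i}. i < \<sigma> c \<longrightarrow> \<sigma> i \<le> \<sigma> c)" using i by auto
      finally show ?thesis .
    qed
    then have "k \<in> closers pex_rule (graph n ?\<tau>) \<longleftrightarrow>
        i < \<sigma> i \<and> i < inv \<sigma> i \<and> (\<forall>c\<in>{1..i}. i < \<sigma> c \<longrightarrow> \<sigma> i \<le> \<sigma> c)"
      unfolding closers_graph[OF q] using k exc_iff aexc_iff by auto
    \<comment> \<open>At an excedance the interval condition splits in two: the value
      \<open>i\<close> does not occur earlier, so \<open>i < inv \<sigma> i\<close>, and no earlier
      value lies above \<open>i\<close> and up to \<open>\<sigma> i\<close>, so
      \<open>\<sigma> i\<close> is least.\<close>
    also have "\<dots> \<longleftrightarrow> \<sigma> i > i \<and> (\<forall>j\<in>{1..<i}. \<sigma> j \<notin> {i..\<sigma> i})"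
    proof (cases "i < \<sigma> i")
      case True
      have eq: "\<sigma> a = \<sigma> b \<longleftrightarrow> a = b" for a b using permutes_inj[OF p] by (auto simp: inj_def)
      have "i < inv \<sigma> i \<longleftrightarrow> (\<forall>j\<in>{1..<i}. \<sigma> j \<noteq> i)"
      proof
        assume "i < inv \<sigma> i"
        then show "\<forall>j\<in>{1..<i}. \<sigma> j \<noteq> i" using inv(2) by fastforce
      next
        assume *: "\<forall>j\<in>{1..<i}. \<sigma> j \<noteq> i"
        have "1 \<le> inv \<sigma> i" using in_iff(2)[of i] i by simp
        moreover have "inv \<sigma> i \<noteq> i" using True inv(1)[of i] by auto
        moreover have "\<sigma> (inv \<sigma> i) = i" by (rule inv)
        ultimately show "i < inv \<sigma> i" using * by (metis atLeastLessThan_iff linorder_neqE_nat)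
      qed
      moreover have "(\<forall>c\<in>{1..i}. i < \<sigma> c \<longrightarrow> \<sigma> i \<le> \<sigma> c) \<longleftrightarrow>
          (\<forall>j\<in>{1..<i}. \<not> (i < \<sigma> j \<and> \<sigma> j \<le> \<sigma> i))"
      proof -
        have "{1..i} = insert i {1..<i}" using i by auto
        moreover have "\<sigma> j \<noteq> \<sigma> i" if "j \<in> {1..<i}" for j using that eq by simp
        ultimately show ?thesis by (auto simp: not_le le_less)
      qed
      ultimately show ?thesis using True by (auto simp: le_less)
    qed simp
    finally show ?thesis by (simp add: k_def)
  qed
  have "closers pex_rule (graph n ?\<tau>) = reflect n ` {i \<in> {1..n}. \<sigma> i > i \<and> (\<forall>j\<in>{1..<i}. \<sigma> j \<notin> {i..\<sigma> i})}"
  proof (intro subset_antisym subsetI)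
    fix k assume k: "k \<in> closers pex_rule (graph n ?\<tau>)"
    then have "reflect n k \<in> {1..n}" unfolding closers_graph[OF q] by (intro reflect_in) simp
    with key[of "reflect n k"] k
    show "k \<in> reflect n ` {i \<in> {1..n}. \<sigma> i > i \<and> (\<forall>j\<in>{1..<i}. \<sigma> j \<notin> {i..\<sigma> i})}"
      by (intro image_eqI[of _ _ "reflect n k"]) simp_all
  qed (use key in auto)
  moreover have "inj (reflect n)" by (rule inj_on_inverseI[of _ "reflect n"]) simp
  ultimately show ?thesis by (simp add: pex_def card_image inj_on_def inj_def)
qed

lemma sum_exc_pcyc:
  fixes x y :: "'a :: comm_ring_1"
  shows "(\<Sum>\<sigma> | \<sigma> permutes {1..n}. x ^ exc n \<sigma> * y ^ pcyc n \<sigma>) = hole_poly x y n 0"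
  unfolding sum_weight_permutes[OF closing_rule_pcyc, symmetric] weight_def card_excs_graph
  by (intro sum.cong refl) (simp add: card_closers_pcyc)

lemma sum_exc_ear:
  fixes x y :: "'a :: comm_ring_1"
  shows "(\<Sum>\<sigma> | \<sigma> permutes {1..n}. x ^ exc n \<sigma> * y ^ ear n \<sigma>) = hole_poly x y n 0"
  unfolding sum_weight_permutes[OF closing_rule_ear, symmetric] weight_def card_excs_graph ear_def
  by (intro sum.cong refl) (simp add: closers_ear)

lemma sum_exc_pex:
  fixes x y :: "'a :: comm_ring_1"
  shows "(\<Sum>\<sigma> | \<sigma> permutes {1..n}. x ^ exc n \<sigma> * y ^ pex n \<sigma>) = hole_poly x y n 0"
proof -
  have "(\<Sum>\<sigma> | \<sigma> permutes {1..n}. x ^ exc n \<sigma> * y ^ pex n \<sigma>) =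
      (\<Sum>\<sigma> | \<sigma> permutes {1..n}. weight x y pex_rule (graph n \<sigma>))"
    by (rule sum.reindex_bij_witness[where i = "reverse_inv n" and j = "reverse_inv n"])
      (auto simp: reverse_inv_reverse_inv reverse_inv_permutes weight_def card_excs_graph
        exc_reverse_inv card_closers_pex simp del: One_nat_def)
  then show ?thesis by (simp only: sum_weight_permutes[OF closing_rule_pex])
qed

section \<open>Descents\<close>

definition descents :: "nat list \<Rightarrow> nat set" where
  "descents w = {i. Suc i < length w \<and> w ! i > w ! Suc i}"

definition record_descents :: "nat list \<Rightarrow> nat set" where
  "record_descents w = {i \<in> descents w. \<forall>j<i. w ! j < w ! i}"

text \<open>Real values allow the later division by factorials in exponential generating
  functions.\<close>

definition desc_weight :: "real \<Rightarrow> real \<Rightarrow> nat list \<Rightarrow> real" where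
  "desc_weight x y w = x ^ card (descents w) * y ^ card (record_descents w)"

text \<open>The letters form an arbitrary set because cutting a word at its maximum leaves words on
  arbitrary complementary subsets.\<close>

definition desc_sum :: "real \<Rightarrow> real \<Rightarrow> nat set \<Rightarrow> real" where
  "desc_sum x y A = (\<Sum>w\<in>permutations_of_set A. desc_weight x y w)"

lemma finite_descents [simp]: "finite (descents w)"
  by (rule finite_subset[of _ "{..<length w}"]) (auto simp: descents_def)

lemma finite_record_descents [simp]: "finite (record_descents w)"
  by (simp add: record_descents_def)

lemma descents_split:
  assumes u: "\<forall>a\<in>set u. a < m" and v: "\<forall>a\<in>set v. a < m"
  shows "descents (u @ m # v) = descents u \<union>
    (if v = [] then {} else insert (length u) ((\<lambda>i. Suc (length u + i)) ` descents v))"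
proof (rule set_eqI)
  fix i
  have um: "u ! j < m" if "j < length u" for j using u that by simp
  have vm: "v ! j < m" if "j < length v" for j using v that by simp
  consider "Suc i < length u" | "Suc i = length u" | "i = length u" | j where "i = Suc (length u + j)"
    by (metis Suc_lessI add_Suc less_iff_Suc_add linorder_neqE_nat)
  then show "i \<in> descents (u @ m # v) \<longleftrightarrow> i \<in> descents u \<union>
    (if v = [] then {} else insert (length u) ((\<lambda>i. Suc (length u + i)) ` descents v))"
  proof cases
    case 1
    then show ?thesis by (auto simp: descents_def nth_append)
  next
    case 2
    then have "i < length u" by simp
    from um[OF this] 2 show ?thesis by (auto simp: descents_def nth_append)
  next
    case 3
    then show ?thesis using vm[of 0] by (auto simp: descents_def nth_append)
  next
    case (4 j)
    then show ?thesis by (auto simp: descents_def nth_append)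
  qed
qed

text \<open>No letter after the maximum \<open>m\<close> is a record, and \<open>m\<close> itself is
  one that descends as soon as a letter follows.\<close>

lemma record_descents_split:
  assumes u: "\<forall>a\<in>set u. a < m" and v: "\<forall>a\<in>set v. a < m"
  shows "record_descents (u @ m # v) = record_descents u \<union> (if v = [] then {} else {length u})"
proof -
  have um: "u ! j < m" if "j < length u" for j using u that by simp
  have A: "i \<in> record_descents (u @ m # v) \<longleftrightarrow> i \<in> record_descents u" if "i \<in> descents u" for i
  proof -
    have "i < length u" using that by (simp add: descents_def)
    then show ?thesis
      using that by (auto simp: record_descents_def descents_split[OF u v] nth_append)
  qed
  have B: "length u \<in> record_descents (u @ m # v)" if "v \<noteq> []"
    using that um by (auto simp: record_descents_def descents_split[OF u v] nth_append)
  have C: "Suc (length u + i) \<notin> record_descents (u @ m # v)" if "i \<in> descents v" for i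
  proof
    assume "Suc (length u + i) \<in> record_descents (u @ m # v)"
    then have *: "\<And>j. j < Suc (length u + i) \<Longrightarrow> (u @ m # v) ! j < (u @ m # v) ! Suc (length u + i)"
      by (simp add: record_descents_def)
    from *[of "length u"] have "m < v ! i" by (simp add: nth_append)
    moreover have "v ! i < m" using v that by (simp add: descents_def)
    ultimately show False by simp
  qed
  have "record_descents w \<subseteq> descents w" for w by (auto simp: record_descents_def)
  then show ?thesis
    using A B C descents_split[OF u v] by (fastforce split: if_splits)
qed

text \<open>A nonempty \<open>v\<close> makes the maximum a record descent, giving the factor
  \<open>x * y\<close>; the descents inside \<open>v\<close> are never record descents, hence the
  parameter 1.\<close>

lemma desc_weight_split:
  assumes u: "\<forall>a\<in>set u. a < m" and v: "\<forall>a\<in>set v. a < m"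
  shows "desc_weight x y (u @ m # v) =
    desc_weight x y u * (if v = [] then 1 else x * y * desc_weight x 1 v)"
proof (cases "v = []")
  case True
  then show ?thesis
    using descents_split[OF u v] record_descents_split[OF u v] by (simp add: desc_weight_def)
next
  case False
  let ?f = "\<lambda>i. Suc (length u + i)"
  have lt: "i < length u" if "i \<in> descents u" for i using that by (simp add: descents_def)
  have "card (descents (u @ m # v)) = card (descents u) + card (insert (length u) (?f ` descents v))"
    unfolding descents_split[OF u v] if_not_P[OF False]
    by (rule card_Un_disjoint) (auto dest: lt)
  also have "card (insert (length u) (?f ` descents v)) = Suc (card (descents v))"
    by (subst card_insert_disjoint) (auto simp: card_image inj_on_def)
  finally have "card (descents (u @ m # v)) = card (descents u) + Suc (card (descents v))" .
  moreover have "card (record_descents (u @ m # v)) = card (record_descents u) + 1"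
    unfolding record_descents_split[OF u v] using False lt
    by (subst card_Un_disjoint) (auto simp: record_descents_def)
  ultimately show ?thesis using False by (simp add: desc_weight_def power_add)
qed

lemma desc_sum_split:
  assumes A: "finite A" "A \<noteq> {}"
  defines "S \<equiv> A - {Max A}"
  shows "desc_sum x y A = (\<Sum>B\<in>Pow S. desc_sum x y B *
    (if S - B = {} then 1 else x * y * desc_sum x 1 (S - B)))"
proof -
  let ?m = "Max A"
  have mA: "?m \<in> A" by (rule Max_in[OF A])
  then have m: "?m \<in> A" "?m \<notin> S" "A = insert ?m S" by (auto simp: S_def)
  have fin: "finite S" using A by (simp add: S_def)
  have less: "a < ?m" if "a \<in> S" for a
    using that A by (metis DiffE Max_ge S_def insertI1 order_neq_le_trans)
  let ?I = "SIGMA B:Pow S. permutations_of_set B \<times> permutations_of_set (S - B)"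
  have "desc_sum x y A = (\<Sum>(B, u, v)\<in>?I. desc_weight x y (u @ ?m # v))"
    unfolding desc_sum_def
  \<comment> \<open>A word corresponds to the prefix before its maximum and the suffix after it; the
    letter set of the prefix is carried along so that the sum can be organised by subsets.\<close>
  proof (rule sum.reindex_bij_witness[where j = "\<lambda>w. (set (takeWhile (\<lambda>a. a \<noteq> ?m) w),
        takeWhile (\<lambda>a. a \<noteq> ?m) w, tl (dropWhile (\<lambda>a. a \<noteq> ?m) w))"
        and i = "\<lambda>(B, u, v). u @ ?m # v"])
    fix w assume "w \<in> permutations_of_set A"
    then have w: "set w = A" "distinct w" by (auto simp: permutations_of_set_def)
    then obtain u v where uv: "w = u @ ?m # v" "?m \<notin> set u"
      using m(1) split_list_first[of ?m w] by auto
    have tw: "takeWhile (\<lambda>a. a \<noteq> ?m) w = u" "tl (dropWhile (\<lambda>a. a \<noteq> ?m) w) = v"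
      using uv by (auto simp: takeWhile_append dropWhile_append)
    show "(case (set (takeWhile (\<lambda>a. a \<noteq> ?m) w), takeWhile (\<lambda>a. a \<noteq> ?m) w,
        tl (dropWhile (\<lambda>a. a \<noteq> ?m) w)) of (B, u, v) \<Rightarrow> u @ ?m # v) = w"
      unfolding tw using uv by simp
    show "(case (set (takeWhile (\<lambda>a. a \<noteq> ?m) w), takeWhile (\<lambda>a. a \<noteq> ?m) w,
        tl (dropWhile (\<lambda>a. a \<noteq> ?m) w)) of (B, u, v) \<Rightarrow> desc_weight x y (u @ ?m # v)) = desc_weight x y w"
      unfolding tw using uv by simp
    have d: "distinct u" "distinct v" "?m \<notin> set v" "set u \<inter> set v = {}"
      using w(2) unfolding uv(1) by auto
    have "insert ?m S = set w" using m(3) w(1) by simp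
    also have "\<dots> = insert ?m (set u \<union> set v)" unfolding uv(1) by simp
    finally have "S = set u \<union> set v"
      using uv(2) m(2) d(3) by (subst (asm) insert_ident) auto
    then have "set u \<subseteq> S" "set v = S - set u" using d(4) by auto
    with d show "(set (takeWhile (\<lambda>a. a \<noteq> ?m) w), takeWhile (\<lambda>a. a \<noteq> ?m) w,
        tl (dropWhile (\<lambda>a. a \<noteq> ?m) w)) \<in> ?I"
      unfolding tw by (auto simp: permutations_of_set_def)
  next
    fix t assume "t \<in> ?I"
    then obtain B u v where t: "t = (B, u, v)" "B \<subseteq> S" "set u = B" "distinct u"
      "set v = S - B" "distinct v"
      by (auto simp: permutations_of_set_def)
    then have nm: "?m \<notin> set u" using m(2) by blast
    then have tw: "takeWhile (\<lambda>a. a \<noteq> ?m) (u @ ?m # v) = u"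
      "dropWhile (\<lambda>a. a \<noteq> ?m) (u @ ?m # v) = ?m # v"
      by (auto simp: takeWhile_append dropWhile_append)
    show "(set (takeWhile (\<lambda>a. a \<noteq> ?m) (case t of (B, u, v) \<Rightarrow> u @ ?m # v)),
        takeWhile (\<lambda>a. a \<noteq> ?m) (case t of (B, u, v) \<Rightarrow> u @ ?m # v),
        tl (dropWhile (\<lambda>a. a \<noteq> ?m) (case t of (B, u, v) \<Rightarrow> u @ ?m # v))) = t"
      unfolding t(1) prod.case tw using t by simp
    have "set (u @ ?m # v) = A" using t m(3) by auto
    moreover have "distinct (u @ ?m # v)" using t nm m(2) by auto
    ultimately show "(case t of (B, u, v) \<Rightarrow> u @ ?m # v) \<in> permutations_of_set A"
      unfolding t(1) prod.case by (intro permutations_of_setI)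
  qed
  also have "\<dots> = (\<Sum>(B, u, v)\<in>?I. desc_weight x y u * (if S - B = {} then 1 else x * y * desc_weight x 1 v))"
  proof (intro sum.cong refl, clarify)
    fix B u v assume "B \<subseteq> S" "u \<in> permutations_of_set B" "v \<in> permutations_of_set (S - B)"
    then have uv: "B \<subseteq> S" "set u = B" "set v = S - B" by (auto simp: permutations_of_set_def)
    have "\<forall>a\<in>set u. a < ?m" "\<forall>a\<in>set v. a < ?m" using uv less by blast+
    moreover have "S - B = {} \<longleftrightarrow> v = []" unfolding uv(3)[symmetric] by simp
    ultimately show "desc_weight x y (u @ ?m # v) =
        desc_weight x y u * (if S - B = {} then 1 else x * y * desc_weight x 1 v)"
      by (simp only: desc_weight_split)
  qed
  also have "\<dots> = (\<Sum>B\<in>Pow S. \<Sum>(u, v)\<in>permutations_of_set B \<times> permutations_of_set (S - B).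
      desc_weight x y u * (if S - B = {} then 1 else x * y * desc_weight x 1 v))"
    using fin by (subst sum.Sigma) (auto intro: finite_subset)
  also have "\<dots> = (\<Sum>B\<in>Pow S. desc_sum x y B * (if S - B = {} then 1 else x * y * desc_sum x 1 (S - B)))"
  proof (rule sum.cong[OF refl])
    fix B
    show "(\<Sum>(u, v)\<in>permutations_of_set B \<times> permutations_of_set (S - B).
        desc_weight x y u * (if S - B = {} then 1 else x * y * desc_weight x 1 v)) =
      desc_sum x y B * (if S - B = {} then 1 else x * y * desc_sum x 1 (S - B))"
    proof -
      have "(\<Sum>v\<in>permutations_of_set (S - B). if S - B = {} then 1 else x * y * desc_weight x 1 v) =
          (if S - B = {} then 1 else x * y * desc_sum x 1 (S - B))"
      proof (cases "S - B = {}")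
        case True
        show ?thesis unfolding True by simp
      next
        case False
        show ?thesis unfolding desc_sum_def if_not_P[OF False] sum_distrib_left by (rule refl)
      qed
      then show ?thesis
        unfolding desc_sum_def[of x y] sum.cartesian_product[symmetric] sum_product[symmetric] by simp
    qed
  qed
  finally show ?thesis .
qed

lemma sum_Pow_card:
  fixes f :: "nat \<Rightarrow> 'a :: comm_semiring_1"
  assumes "finite S"
  shows "(\<Sum>B\<in>Pow S. f (card B)) = (\<Sum>k\<le>card S. of_nat (card S choose k) * f k)"
proof -
  have "(\<Sum>B\<in>Pow S. f (card B)) = (\<Sum>k\<le>card S. \<Sum>B\<in>{B \<in> Pow S. card B = k}. f (card B))"
    using assms by (intro sum.group[symmetric]) (auto simp: card_mono)
  also have "\<dots> = (\<Sum>k\<le>card S. of_nat (card S choose k) * f k)"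
  proof (rule sum.cong[OF refl])
    fix k
    have "card {B \<in> Pow S. card B = k} = card S choose k"
      using n_subsets[OF assms, of k] by (simp add: Pow_def)
    then show "(\<Sum>B\<in>{B \<in> Pow S. card B = k}. f (card B)) = of_nat (card S choose k) * f k"
      by simp
  qed
  finally show ?thesis .
qed

abbreviation desc_num :: "real \<Rightarrow> real \<Rightarrow> nat \<Rightarrow> real" where
  "desc_num x y n \<equiv> desc_sum x y {..<n}"

lemma desc_sum_empty: "desc_sum x y {} = 1"
  by (simp add: desc_sum_def desc_weight_def descents_def record_descents_def)

text \<open>The summands of \<open>desc_sum_split\<close> depend only on the size of
  \<open>B\<close>, which brings in binomial coefficients. Invariance under change of letters is a
  hypothesis, so the same statement serves the induction proving it and afterwards
  \<open>desc_num_Suc\<close>.\<close>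

lemma desc_sum_card_aux:
  assumes "finite A" "card A = Suc n"
    and IH: "\<And>y B. finite B \<Longrightarrow> card B \<le> n \<Longrightarrow> desc_sum x y B = desc_num x y (card B)"
  shows "desc_sum x y A = (\<Sum>k\<le>n. of_nat (n choose k) *
    (desc_num x y k * (if n - k = 0 then 1 else x * y * desc_num x 1 (n - k))))"
proof -
  define S where "S = A - {Max A}"
  have ne: "A \<noteq> {}" using assms(2) by auto
  have S: "finite S" "card S = n" using assms(1,2) Max_in[OF assms(1) ne] by (simp_all add: S_def)
  have "desc_sum x y A = (\<Sum>B\<in>Pow S. desc_num x y (card B) *
      (if n - card B = 0 then 1 else x * y * desc_num x 1 (n - card B)))"
    unfolding desc_sum_split[OF assms(1) ne] S_def[symmetric]
  proof (rule sum.cong[OF refl])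
    fix B assume "B \<in> Pow S"
    then have sub: "B \<subseteq> S" by simp
    have finB: "finite B" using sub S(1) by (rule finite_subset)
    have B: "finite B" "card B \<le> n" "card (S - B) = n - card B" "finite (S - B)"
      using card_mono[OF S(1) sub] card_Diff_subset[OF finB sub] S finB by simp_all
    have "desc_sum x y B = desc_num x y (card B)" by (rule IH[OF B(1,2)])
    moreover have "desc_sum x 1 (S - B) = desc_num x 1 (n - card B)"
      unfolding B(3)[symmetric] by (rule IH) (use B in simp_all)
    moreover have "S - B = {} \<longleftrightarrow> n - card B = 0" unfolding B(3)[symmetric] using B(4) by simp
    ultimately show "desc_sum x y B * (if S - B = {} then 1 else x * y * desc_sum x 1 (S - B)) =
      desc_num x y (card B) * (if n - card B = 0 then 1 else x * y * desc_num x 1 (n - card B))"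
      by (simp only:)
  qed
  also have "\<dots> = (\<Sum>k\<le>n. of_nat (n choose k) *
      (desc_num x y k * (if n - k = 0 then 1 else x * y * desc_num x 1 (n - k))))"
    using sum_Pow_card[OF S(1), of "\<lambda>k. desc_num x y k * (if n - k = 0 then 1 else x * y * desc_num x 1 (n - k))"]
    by (simp only: S(2))
  finally show ?thesis .
qed

text \<open>Letter sets of equal size expand to the same right-hand side. The induction generalises
  \<open>y\<close> because suffixes occur with the parameter 1.\<close>

lemma desc_sum_card: "finite A \<Longrightarrow> desc_sum x y A = desc_num x y (card A)"
proof (induction "card A" arbitrary: A y rule: less_induct)
  case less
  show ?case
  proof (cases "card A")
    case 0
    then show ?thesis using less.prems by simp
  next
    case (Suc n)
    have IH: "desc_sum x y B = desc_num x y (card B)" if "finite B" "card B \<le> n" for y B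
      using less.hyps[of B y] that Suc by simp
    show ?thesis
      unfolding Suc
      by (rule trans[OF desc_sum_card_aux[OF less.prems Suc IH] desc_sum_card_aux[OF _ _ IH, symmetric]])
        simp_all
  qed
qed

lemma desc_num_Suc:
  "desc_num x y (Suc n) = (\<Sum>k\<le>n. of_nat (n choose k) *
    (desc_num x y k * (if n - k = 0 then 1 else x * y * desc_num x 1 (n - k))))"
  by (rule desc_sum_card_aux[OF _ _ desc_sum_card]) simp_all

section \<open>Exponential generating functions of descents\<close>

definition desc_egf :: "real \<Rightarrow> real \<Rightarrow> real fps" where
  "desc_egf x y = Abs_fps (\<lambda>n. desc_num x y n / fact n)"

text \<open>The binomial convolution in \<open>desc_num_Suc\<close> is a product of exponential
  generating functions. The constant term 1 of the second factor stands for an empty suffix.\<close>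

lemma desc_egf_deriv:
  "fps_deriv (desc_egf x y) = desc_egf x y * (1 + fps_const (x * y) * (desc_egf x 1 - 1))"
proof (rule fps_ext)
  fix n
  let ?c = "\<lambda>j. if j = 0 then 1 else x * y * desc_num x 1 j"
  have c: "fps_nth (1 + fps_const (x * y) * (desc_egf x 1 - 1)) j = ?c j / fact j" for j
    by (cases "j = 0") (auto simp: desc_egf_def desc_sum_empty)
  have "fps_nth (fps_deriv (desc_egf x y)) n = desc_num x y (Suc n) / fact n"
    by (simp add: desc_egf_def field_simps del: of_nat_Suc)
  also have "\<dots> = (\<Sum>k\<le>n. (desc_num x y k / fact k) * (?c (n - k) / fact (n - k)))"
    unfolding desc_num_Suc sum_divide_distrib
    by (intro sum.cong refl) (simp add: binomial_fact field_simps)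
  also have "\<dots> = fps_nth (desc_egf x y * (1 + fps_const (x * y) * (desc_egf x 1 - 1))) n"
    unfolding fps_mult_nth c by (simp add: desc_egf_def atLeast0AtMost)
  finally show "fps_nth (fps_deriv (desc_egf x y)) n =
    fps_nth (desc_egf x y * (1 + fps_const (x * y) * (desc_egf x 1 - 1))) n" .
qed

text \<open>The powers of \<open>desc_egf x 1 - 1\<close> play the role of the holes:
  differentiation, which shifts \<open>n\<close>, reproduces the recurrence of
  \<open>hole_poly\<close>. The case \<open>h = 0\<close> is the one wanted.\<close>

lemma hole_poly_egf:
  "fps_nth (desc_egf x y * (desc_egf x 1 - 1) ^ h) n * fact n = fact h * hole_poly x y n h"
proof (induction n arbitrary: h)
  case 0
  then show ?case by (simp add: desc_egf_def desc_sum_empty fps_nth_power_0 power_0_left)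
next
  case (Suc n)
  define p t where "p = desc_egf x y" and "t = desc_egf x 1 - 1"
  have IH: "fps_nth (p * t ^ h) n * fact n = fact h * hole_poly x y n h" for h
    using Suc.IH by (simp add: p_def t_def)
  have dp: "fps_deriv p = p * (1 + fps_const (x * y) * t)"
    unfolding p_def t_def by (rule desc_egf_deriv)
  have dt: "fps_deriv t = (1 + t) * (1 + fps_const x * t)"
    using desc_egf_deriv[of x 1] by (simp add: t_def)
  let ?c = "fps_const (of_nat h :: real)"
  have coeffs: "fps_const (1 + of_nat h * (1 + x)) = 1 + ?c * (1 + fps_const x)"
    "fps_const (x * (of_nat h + y)) = ?c * fps_const x + fps_const (x * y)"
    by (simp_all add: algebra_simps flip: fps_const_1_eq_1)
  \<comment> \<open>As \<open>dt\<close> is quadratic in \<open>t\<close>, only the exponents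
    \<open>h - 1\<close>, \<open>h\<close> and \<open>h + 1\<close> occur. For \<open>h = 0\<close>
    the truncated exponent has coefficient \<open>?c = 0\<close>.\<close>
  have "fps_deriv (p * t ^ h) = fps_const (1 + of_nat h * (1 + x)) * (p * t ^ h) +
      fps_const (x * (of_nat h + y)) * (p * t ^ Suc h) + ?c * (p * t ^ (h - 1))"
  proof (cases h)
    case 0
    then show ?thesis by (simp add: dp distrib_left mult.left_commute)
  next
    case (Suc g)
    have ring: "p * (c * ((1 + t) * (1 + a * t)) * s) + p * (1 + b * t) * (t * s) =
        (1 + c * (1 + a)) * (p * (t * s)) + (c * a + b) * (p * (t * (t * s))) + c * (p * s)"
      for a b c s :: "real fps"
      by (simp add: algebra_simps)
    show ?thesis
      unfolding coeffs fps_deriv_mult fps_deriv_power dp dt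
      unfolding Suc diff_Suc_1 power_Suc by (rule ring)
  qed
  then have "fps_nth (fps_deriv (p * t ^ h)) n =
      (1 + of_nat h * (1 + x)) * fps_nth (p * t ^ h) n +
      x * (of_nat h + y) * fps_nth (p * t ^ Suc h) n + of_nat h * fps_nth (p * t ^ (h - 1)) n"
    by (simp only: fps_add_nth fps_mult_left_const_nth)
  then have "fps_nth (fps_deriv (p * t ^ h)) n * fact n =
      (1 + of_nat h * (1 + x)) * (fps_nth (p * t ^ h) n * fact n) +
      x * (of_nat h + y) * (fps_nth (p * t ^ Suc h) n * fact n) +
      of_nat h * (fps_nth (p * t ^ (h - 1)) n * fact n)"
    by (simp only: distrib_right mult.assoc)
  \<comment> \<open>The ratio of \<open>fact (Suc h)\<close> to \<open>fact h\<close> supplies the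
    factor \<open>h + 1\<close> of the recurrence, and \<open>h\<close> times
    \<open>fact (h - 1)\<close> is \<open>fact h\<close>.\<close>
  also have "\<dots> = fact h * hole_poly x y (Suc n) h"
    unfolding IH by (cases h) (simp_all add: algebra_simps)
  also have "fps_nth (fps_deriv (p * t ^ h)) n * fact n = fps_nth (p * t ^ h) (Suc n) * fact (Suc n)"
    by (simp only: fps_deriv_nth) (simp add: mult_ac)
  finally show ?case by (simp only: p_def t_def)
qed

lemma desc_num_eq_hole_poly: "desc_num x y n = hole_poly x y n 0"
  using hole_poly_egf[of x y 0 n] by (simp add: desc_egf_def)

section \<open>Permutations as words\<close>

lemma bij_betw_permutes_lists:
  "bij_betw (\<lambda>\<sigma>. map \<sigma> [1..<Suc n]) {\<sigma>. \<sigma> permutes {1..n}} (permutations_of_set {1..n})"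
proof -
  let ?f = "\<lambda>\<sigma>. map \<sigma> [1..<Suc n]" and ?P = "{\<sigma>. \<sigma> permutes {1..n}}"
  have upt: "set [1..<Suc n] = {1..n}" by auto
  have inj: "inj_on ?f ?P"
  proof (rule inj_onI)
    fix \<sigma> \<tau> assume p: "\<sigma> \<in> ?P" "\<tau> \<in> ?P" and "map \<sigma> [1..<Suc n] = map \<tau> [1..<Suc n]"
    then have eq: "\<sigma> i = \<tau> i" if "i \<in> {1..n}" for i
      using that unfolding map_eq_conv upt by blast
    show "\<sigma> = \<tau>"
    proof
      fix i show "\<sigma> i = \<tau> i"
        using eq[of i] p permutes_not_in[of \<sigma> "{1..n}" i] permutes_not_in[of \<tau> "{1..n}" i]
        by (cases "i \<in> {1..n}") (simp_all only: mem_Collect_eq simp_thms)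
    qed
  qed
  have "?f ` ?P \<subseteq> permutations_of_set {1..n}"
  proof (rule image_subsetI)
    fix \<sigma> assume "\<sigma> \<in> ?P"
    then have p: "\<sigma> permutes {1..n}" by simp
    show "?f \<sigma> \<in> permutations_of_set {1..n}"
    proof (rule permutations_of_setI)
      show "set (?f \<sigma>) = {1..n}" unfolding set_map upt by (rule permutes_image[OF p])
      show "distinct (?f \<sigma>)" unfolding distinct_map upt using permutes_inj_on[OF p] by simp
    qed
  qed
  \<comment> \<open>Surjectivity comes from counting, as both sides have \<open>fact n\<close>
    elements.\<close>
  moreover have "card (?f ` ?P) = card (permutations_of_set {1..n})"
    by (simp add: card_image[OF inj] card_permutations[of "{1..n}" n] del: One_nat_def upt_Suc)
  ultimately have "?f ` ?P = permutations_of_set {1..n}"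
    by (intro card_subset_eq) simp_all
  with inj show ?thesis by (simp add: bij_betw_def)
qed

lemma nth_map_upt: "i < n \<Longrightarrow> map \<sigma> [1..<Suc n] ! i = \<sigma> (Suc i)"
  by (simp del: upt_Suc)

text \<open>List positions start at 0 and permutation indices at 1, so \<open>Suc\<close> matches
  the two sets of descents.\<close>

lemma card_descents_map: "card (descents (map \<sigma> [1..<Suc n])) = des n \<sigma>"
proof -
  have "{i \<in> {1..<n}. is_descent n \<sigma> i} = Suc ` descents (map \<sigma> [1..<Suc n])" (is "?L = ?R")
  proof (rule set_eqI)
    fix i show "i \<in> ?L \<longleftrightarrow> i \<in> ?R"
      by (cases i) (auto simp: is_descent_def descents_def nth_map_upt simp del: upt_Suc)
  qed
  then show ?thesis by (simp add: des_def card_image del: upt_Suc)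
qed

lemma card_record_descents_map: "card (record_descents (map \<sigma> [1..<Suc n])) = des2 n \<sigma>"
proof -
  have ball: "(\<forall>j\<in>{1..<Suc i}. \<sigma> j < \<sigma> (Suc i)) \<longleftrightarrow> (\<forall>j<i. \<sigma> (Suc j) < \<sigma> (Suc i))" for i
    by (auto simp: Ball_def gr0_conv_Suc Suc_le_eq)
  have "{i \<in> {1..<n}. is_descent n \<sigma> i \<and> (\<forall>j\<in>{1..<i}. \<sigma> j < \<sigma> i)} =
      Suc ` record_descents (map \<sigma> [1..<Suc n])" (is "?L = ?R")
  proof (rule set_eqI)
    fix i show "i \<in> ?L \<longleftrightarrow> i \<in> ?R"
    proof (cases i)
      case (Suc k)
      have "i \<in> ?L \<longleftrightarrow> Suc k < n \<and> \<sigma> (Suc k) > \<sigma> (Suc (Suc k)) \<and> (\<forall>j<k. \<sigma> (Suc j) < \<sigma> (Suc k))"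
        unfolding Suc mem_Collect_eq ball by (auto simp: is_descent_def)
      also have "\<dots> \<longleftrightarrow> k \<in> record_descents (map \<sigma> [1..<Suc n])"
        by (auto simp: record_descents_def descents_def nth_map_upt simp del: upt_Suc)
      finally show ?thesis using Suc by auto
    qed auto
  qed
  then show ?thesis by (simp add: des2_def card_image del: upt_Suc)
qed

lemma sum_des_des2:
  fixes x y :: real
  shows "(\<Sum>\<sigma> | \<sigma> permutes {1..n}. x ^ des n \<sigma> * y ^ des2 n \<sigma>) = hole_poly x y n 0"
proof -
  have "(\<Sum>\<sigma> | \<sigma> permutes {1..n}. x ^ des n \<sigma> * y ^ des2 n \<sigma>) = desc_sum x y {1..n}"
    unfolding desc_sum_def sum.reindex_bij_betw[OF bij_betw_permutes_lists, symmetric]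
      desc_weight_def card_descents_map card_record_descents_map by (rule refl)
  \<comment> \<open>Only the number of letters matters, so \<open>{1..n}\<close> may be replaced by
    \<open>{..<n}\<close>.\<close>
  also have "\<dots> = desc_num x y n"
    using desc_sum_card[of "{1..n}" x y] by (simp only: card_atLeastAtMost diff_Suc_1 finite_atLeastAtMost)
  finally show ?thesis by (simp only: desc_num_eq_hole_poly)
qed

section \<open>Polynomial identities from evaluations\<close>

text \<open>For each constant \<open>[:c:]\<close> the two values are integer polynomials agreeing
  at all integers, hence equal. So \<open>P - Q\<close> has infinitely many roots in the integral
  domain of integer polynomials.\<close>

lemma poly_poly_eqI:
  fixes P Q :: "int poly poly"
  assumes "\<And>c d. poly (poly P [:c:]) d = poly (poly Q [:c:]) d"
  shows "P = Q"
proof (rule ccontr)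
  assume "P \<noteq> Q"
  then have "finite {q. poly (P - Q) q = 0}" by (intro poly_roots_finite) simp
  moreover have "range (\<lambda>c. [:c:]) \<subseteq> {q. poly (P - Q) q = 0}"
    using assms by (auto simp: poly_eq_poly_eq_iff[symmetric] fun_eq_iff)
  ultimately have "finite (range (\<lambda>c :: int. [:c:]))" by (rule rev_finite_subset)
  moreover have "inj (\<lambda>c :: int. [:c:])" by (simp add: inj_def)
  ultimately show False using finite_imageD infinite_UNIV_int by blast
qed

lemma bistat_poly_eqI:
  assumes "\<And>x y :: real. (\<Sum>\<sigma> | \<sigma> permutes {1..n}. x ^ s1 \<sigma> * y ^ s2 \<sigma>) =
      (\<Sum>\<sigma> | \<sigma> permutes {1..n}. x ^ t1 \<sigma> * y ^ t2 \<sigma>)"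
  shows "bistat_poly n s1 s2 = bistat_poly n t1 t2"
proof (rule poly_poly_eqI)
  fix c d :: int
  \<comment> \<open>Evaluating the outer variable at \<open>[:c:]\<close> and the inner one at
    \<open>d\<close> substitutes \<open>c\<close> for \<open>x\<close> and \<open>d\<close> for
    \<open>y\<close>; the embedding into the reals is injective, so real identities suffice.\<close>
  have ev: "of_int (poly (poly (bistat_poly n u1 u2) [:c:]) d) =
      (\<Sum>\<sigma> | \<sigma> permutes {1..n}. (of_int c :: real) ^ u1 \<sigma> * of_int d ^ u2 \<sigma>)" for u1 u2
    by (simp add: bistat_poly_def poly_sum)
  have "(of_int (poly (poly (bistat_poly n s1 s2) [:c:]) d) :: real) =
      of_int (poly (poly (bistat_poly n t1 t2) [:c:]) d)"
    unfolding ev by (rule assms)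
  then show "poly (poly (bistat_poly n s1 s2) [:c:]) d = poly (poly (bistat_poly n t1 t2) [:c:]) d"
    by (simp only: of_int_eq_iff)
qed

theorem corollary1p6:
  fixes n :: nat
  assumes "n \<ge> 1"
  shows "bistat_poly n (exc n) (pcyc n) = bistat_poly n (exc n) (ear n)
       \<and> bistat_poly n (exc n) (ear n) = bistat_poly n (des n) (des2 n)
       \<and> bistat_poly n (des n) (des2 n) = bistat_poly n (exc n) (pex n)"
  \<comment> \<open>All four real sums equal \<open>hole_poly x y n 0\<close>.\<close>
  by (intro conjI bistat_poly_eqI)
    (simp_all only: sum_exc_pcyc sum_exc_ear sum_exc_pex sum_des_des2)

end
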